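(* Let $F$ be an infinite field and let $d \in \mathbb{N}$. For every $n \in \mathbb{N}$, every finite set $\Omega \subseteq \mathbb{N}\setminus\{1,\ldots,n\}$, and every nonzero admissible partially commutative polynomial $f \in F\langle X_1,\ldots,X_n\rangle \amalg F[U_\omega \mid \omega \in \Omega]$, there exists an $s \in \mathbb{N}$ such that $\mathrm{sl}_d(F) \subseteq f(M_s(F))$.
   Context: $\mathbb{N}$ denotes the positive integers. Partially commutative polynomials: for $n \in \mathbb{N}$ and a finite (possibly empty) set $\Omega = \{\omega_1,\ldots,\omega_m\} \subseteq \mathbb{N}\setminus\{1,\ldots,n\}$, $F\langle X_1,\ldots,X_n\rangle \amalg F[U_\omega \mid \omega \in \Omega]$ denotes the coproduct (of unital associative $F$-algebras) of the free algebra $F\langle X_1,\ldots,X_n\rangle$ and the commutative polynomial algebra $F[U_\omega \mid \omega\in\Omega]$; its elements are polynomials in variables $X_i, U_\omega$ where the $U_\omega$ commute among themselves but not with the $X_i$. Image: for a unital $F$-algebra $A$ and elements $x_1,\ldots,x_n, u_{\omega_1},\ldots,u_{\omega_m} \in A$ such that the $u_{\omega_j}$ commute with each other, let $\mathrm{Ev}_{x_1,\ldots,x_n;u_{\omega_1},\ldots,u_{\omega_m}}$ be the algebra homomorphism from this coproduct to $A$ sending $X_i \mapsto x_i$, $U_\omega \mapsto u_\omega$. The image of $f$ in $A$ is the set $f(A)$ of all $\mathrm{Ev}_{x_1,\ldots,x_n;u_{\omega_1},\ldots,u_{\omega_m}}(f)$ with $x_i, u_{\omega_j} \in A$ and $u_{\omega_j}u_{\omega_k}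 = u_{\omega_k}u_{\omega_j}$ for all $j,k$. Partitions: $\mathscr{A}_\Omega$ is the set of all $n$-tuples $\mathbf{a} = (\mathbf{a}^1,\ldots,\mathbf{a}^n)$ of strictly increasing (possibly empty) finite sequences $\mathbf{a}^i = (\mathbf{a}^i_1,\ldots,\mathbf{a}^i_{k_i})$ of elements of $\Omega$ such that each $\omega \in \Omega$ equals $\mathbf{a}^i_j$ for exactly one pair $(i,j)$. Commutators: $[x_1,x_2] = x_1x_2 - x_2x_1$ and $[x_1,x_2,\ldots,x_r] = [x_1,[x_2,\ldots,x_r]]$. For $\mathbf{a} \in \mathscr{A}_\Omega$ put $X_i^{\mathbf{a}} = [U_{\mathbf{a}^i_1},\ldots,U_{\mathbf{a}^i_{k_i}},X_i]$ if $k_i > 0$ and $X_i^{\mathbf{a}} = X_i$ if $k_i = 0$, and $(X_{i_1}\cdots X_{i_r})^{\mathbf{a}} = X_{i_1}^{\mathbf{a}}\cdots X_{i_r}^{\mathbf{a}}$. Admissible: $f$ is admissible if it is of the form $f = \sum_{\sigma \in S_n}\sum_{\mathbf{a} \in \mathscr{A}_\Omega} \lambda_\sigma^{\mathbf{a}} (X_{\sigma(1)}X_{\sigma(2)}\cdots X_{\sigma(n)})^{\mathbf{a}}$ with $\lambda_\sigma^{\mathbf{a}} \in F$. $\mathrm{sl}_d(F)$ is the space of all trace zero matrices in $M_d(F)$. For $s \ge d$, $M_d(F)$ is regarded as a subset of $M_s(F)$ via the upper-left corner embedding $a \mapsto \begin{pmatrix} a & 0 \\ 0 & 0\end{pmatrix}$;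 the inclusion $\mathrm{sl}_d(F) \subseteq f(M_s(F))$ is understood with $s\ge d$ and through this embedding. *)

theory Defs
  imports
    "HOL-Library.Poly_Mapping"
    "HOL-Combinatorics.Permutations"
    "Jordan_Normal_Form.Matrix"
begin

section \<open>Partially commutative polynomials\<close>

text \<open>
  The coproduct of a free algebra and a commutative polynomial algebra is the monoid algebra of the
  coproduct of the free monoid on the \<open>X\<^sub>i\<close> and the free commutative monoid on the \<open>U\<^sub>\<omega>\<close>.
  Every element of that monoid is uniquely \<open>U^M\<^sub>0 X\<^sub>i\<^sub>1 U^M\<^sub>1 X\<^sub>i\<^sub>2 \<dots> X\<^sub>i\<^sub>k U^M\<^sub>k\<close> with multisets \<open>M\<^sub>j\<close>:
  \<open>UMon M\<close> stands for \<open>U^M\<close>, and \<open>UXMon M i w\<close> for \<open>U^M X\<^sub>i w\<close>.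
  The monoid is written additively, as the product of \<open>Poly_Mapping\<close> requires.
\<close>

datatype pc_mon = UMon "nat multiset" | UXMon "nat multiset" nat pc_mon

primrec pc_mon_lmul :: "nat multiset \<Rightarrow> pc_mon \<Rightarrow> pc_mon" where
  "pc_mon_lmul M (UMon N) = UMon (M + N)"
| "pc_mon_lmul M (UXMon N i w) = UXMon (M + N) i w"

instantiation pc_mon :: monoid_add
begin

definition zero_pc_mon :: pc_mon where
  "0 = UMon {#}"

primrec plus_pc_mon :: "pc_mon \<Rightarrow> pc_mon \<Rightarrow> pc_mon" where
  "UMon M + w = pc_mon_lmul M w"
| "UXMon M i v + w = UXMon M i (v + w)"

instance
proof
  have lmul: "pc_mon_lmul M (v + w) = pc_mon_lmul M v + w" for M v and w :: pc_mon
    by (cases v; cases w) (simp_all add: add.assoc)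
  show "a + b + c = a + (b + c)" for a b c :: pc_mon
    by (induction a) (simp_all add: lmul)
  show "0 + a = a" for a :: pc_mon
    by (cases a) (simp_all add: zero_pc_mon_def)
  show "a + 0 = a" for a :: pc_mon
    by (induction a) (simp_all add: zero_pc_mon_def)
qed

end

primrec xvars :: "pc_mon \<Rightarrow> nat set" where
  "xvars (UMon M) = {}"
| "xvars (UXMon M i w) = insert i (xvars w)"

primrec uvars :: "pc_mon \<Rightarrow> nat set" where
  "uvars (UMon M) = set_mset M"
| "uvars (UXMon M i w) = set_mset M \<union> uvars w"

type_synonym 'f pc_poly = "pc_mon \<Rightarrow>\<^sub>0 'f"

text \<open>The algebra \<open>F\<langle>X\<^sub>1,\<dots>,X\<^sub>n\<rangle> \<amalg> F[U\<^sub>\<omega> | \<omega> \<in> \<Omega>]\<close>, as a subalgebra of the one on all variables.\<close>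

definition pc_polys :: "nat \<Rightarrow> nat set \<Rightarrow> 'f::field pc_poly set" where
  "pc_polys n \<Omega> = {f. \<forall>w\<in>Poly_Mapping.keys f. xvars w \<subseteq> {1..n} \<and> uvars w \<subseteq> \<Omega>}"

definition pc_const :: "'f::field \<Rightarrow> 'f pc_poly" where
  "pc_const c = Poly_Mapping.single 0 c"

definition pc_X :: "nat \<Rightarrow> 'f::field pc_poly" where
  "pc_X i = Poly_Mapping.single (UXMon {#} i (UMon {#})) 1"

definition pc_U :: "nat \<Rightarrow> 'f::field pc_poly" where
  "pc_U \<omega> = Poly_Mapping.single (UMon {#\<omega>#}) 1"


section \<open>Evaluation and image\<close>

text \<open>In the following, a (unital associative) algebra is given by a record of type
  \<open>module\<close>, which has fields for the ring operations and for the scalar multiplication.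
  The order of the factors chosen in \<open>ev_umon\<close> is irrelevant as soon as the \<open>u \<omega>\<close> commute.\<close>

definition ev_umon :: "('f, 'v) module \<Rightarrow> (nat \<Rightarrow> 'v) \<Rightarrow> nat multiset \<Rightarrow> 'v" where
  "ev_umon A u M = foldr (\<lambda>\<omega> a. u \<omega> \<otimes>\<^bsub>A\<^esub> a) (sorted_list_of_multiset M) \<one>\<^bsub>A\<^esub>"

primrec ev_mon :: "('f, 'v) module \<Rightarrow> (nat \<Rightarrow> 'v) \<Rightarrow> (nat \<Rightarrow> 'v) \<Rightarrow> pc_mon \<Rightarrow> 'v" where
  "ev_mon A x u (UMon M) = ev_umon A u M"
| "ev_mon A x u (UXMon M i w) = ev_umon A u M \<otimes>\<^bsub>A\<^esub> (x i \<otimes>\<^bsub>A\<^esub> ev_mon A x u w)"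

definition pc_ev ::
  "('f::field, 'v) module \<Rightarrow> (nat \<Rightarrow> 'v) \<Rightarrow> (nat \<Rightarrow> 'v) \<Rightarrow> 'f pc_poly \<Rightarrow> 'v" where
  "pc_ev A x u f = (\<Oplus>\<^bsub>A\<^esub>w\<in>Poly_Mapping.keys f. Poly_Mapping.lookup f w \<odot>\<^bsub>A\<^esub> ev_mon A x u w)"

definition pc_image ::
  "('f::field, 'v) module \<Rightarrow> nat \<Rightarrow> nat set \<Rightarrow> 'f pc_poly \<Rightarrow> 'v set" where
  "pc_image A n \<Omega> f = {pc_ev A x u f | x u.
     (\<forall>i\<in>{1..n}. x i \<in> carrier A) \<and> (\<forall>\<omega>\<in>\<Omega>. u \<omega> \<in> carrier A) \<and>
     (\<forall>\<omega>\<in>\<Omega>. \<forall>\<omega>'\<in>\<Omega>. u \<omega> \<otimes>\<^bsub>A\<^esub> u \<omega>' = u \<omega>' \<otimes>\<^bsub>A\<^esub> u \<omega>)}"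


section \<open>Admissible polynomials\<close>

definition commutator :: "'a::ring \<Rightarrow> 'a \<Rightarrow> 'a" where
  "commutator a b = a * b - b * a"

fun nested_commutator :: "'a::ring list \<Rightarrow> 'a" where
  "nested_commutator [] = 0"
| "nested_commutator [a] = a"
| "nested_commutator (a # b # as) = commutator a (nested_commutator (b # as))"

text \<open>An \<open>n\<close>-tuple of sequences is a function on \<open>{1..n}\<close>; using \<open>\<rightarrow>\<^sub>E\<close> makes the representation
  unique, so that the sum in the definition of admissibility has exactly one summand per tuple.
  Positions in the sequences are counted from \<open>0\<close>.\<close>

definition seq_partitions :: "nat \<Rightarrow> nat set \<Rightarrow> (nat \<Rightarrow> nat list) set" where
  "seq_partitions n \<Omega> =
     {a \<in> {1..n} \<rightarrow>\<^sub>E {xs. sorted_wrt (<) xs \<and> set xs \<subseteq> \<Omega>}.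
        \<forall>\<omega>\<in>\<Omega>. \<exists>!p. case p of (i, j) \<Rightarrow> i \<in> {1..n} \<and> j < length (a i) \<and> a i ! j = \<omega>}"

definition pc_X_sup :: "(nat \<Rightarrow> nat list) \<Rightarrow> nat \<Rightarrow> 'f::field pc_poly" where
  "pc_X_sup a i = nested_commutator (map pc_U (a i) @ [pc_X i])"

definition admissible :: "nat \<Rightarrow> nat set \<Rightarrow> 'f::field pc_poly \<Rightarrow> bool" where
  "admissible n \<Omega> f \<longleftrightarrow>
     (\<exists>l :: (nat \<Rightarrow> nat) \<Rightarrow> (nat \<Rightarrow> nat list) \<Rightarrow> 'f.
        f = (\<Sum>\<sigma> | \<sigma> permutes {1..n}. \<Sum>a\<in>seq_partitions n \<Omega>.
               pc_const (l \<sigma> a) * prod_list (map (\<lambda>i. pc_X_sup a (\<sigma> i)) [1..<n+1])))"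

lemma finite_seq_partitions:
  assumes "finite \<Omega>"
  shows "finite (seq_partitions n \<Omega>)"
proof -
  have "{xs. sorted_wrt (<) xs \<and> set xs \<subseteq> \<Omega>} \<subseteq> {xs. set xs \<subseteq> \<Omega> \<and> distinct xs}"
    by (auto simp: strict_sorted_iff)
  hence "finite {xs. sorted_wrt (<) xs \<and> set xs \<subseteq> \<Omega>}"
    using finite_subset_distinct[OF assms] finite_subset by blast
  thus ?thesis
    unfolding seq_partitions_def
    by (intro finite_subset[OF _ finite_PiE[of "{1..n}"
          "\<lambda>_. {xs. sorted_wrt (<) xs \<and> set xs \<subseteq> \<Omega>}"]]) auto
qed


section \<open>Matrices\<close>

definition mat_trace :: "'a::comm_monoid_add mat \<Rightarrow> 'a" where
  "mat_trace B = (\<Sum>i<dim_row B. B $$ (i, i))"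

definition sl_mat :: "nat \<Rightarrow> 'a::field mat set" where
  "sl_mat d = {B \<in> carrier_mat d d. mat_trace B = 0}"

definition embed_mat :: "nat \<Rightarrow> nat \<Rightarrow> 'a::zero mat \<Rightarrow> 'a mat" where
  "embed_mat d s B =
     four_block_mat B (0\<^sub>m d (s - d)) (0\<^sub>m (s - d) d) (0\<^sub>m (s - d) (s - d))"

abbreviation mat_algebra :: "'a::field itself \<Rightarrow> nat \<Rightarrow> ('a, 'a mat) module" where
  "mat_algebra ty s \<equiv> module_mat ty s s"


section \<open>The universal property of the coproduct\<close>

text \<open>The facts below confirm that \<open>pc_ev\<close> is the unique algebra homomorphism
  with \<open>X\<^sub>i \<mapsto> x\<^sub>i\<close> and \<open>U\<^sub>\<omega> \<mapsto> u\<^sub>\<omega>\<close>.\<close>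

locale unital_algebra = ring A for A :: "('f::field, 'v) module" (structure) +
  assumes smult_closed [simp]: "a \<in> carrier A \<Longrightarrow> c \<odot> a \<in> carrier A"
    and smult_l_distr: "a \<in> carrier A \<Longrightarrow> (c + c') \<odot> a = c \<odot> a \<oplus> c' \<odot> a"
    and smult_r_distr: "\<lbrakk>a \<in> carrier A; b \<in> carrier A\<rbrakk> \<Longrightarrow> c \<odot> (a \<oplus> b) = c \<odot> a \<oplus> c \<odot> b"
    and smult_assoc: "a \<in> carrier A \<Longrightarrow> (c * c') \<odot> a = c \<odot> (c' \<odot> a)"
    and smult_one [simp]: "a \<in> carrier A \<Longrightarrow> 1 \<odot> a = a"
    and smult_mult_l: "\<lbrakk>a \<in> carrier A; b \<in> carrier A\<rbrakk> \<Longrightarrow> (c \<odot> a) \<otimes> b = c \<odot> (a \<otimes> b)"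
    and smult_mult_r: "\<lbrakk>a \<in> carrier A; b \<in> carrier A\<rbrakk> \<Longrightarrow> a \<otimes> (c \<odot> b) = c \<odot> (a \<otimes> b)"
begin

lemma smult_zero [simp]: "a \<in> carrier A \<Longrightarrow> 0 \<odot> a = \<zero>"
  using smult_l_distr[of a 0 0] by (simp add: add.r_cancel_one')

end

lemma unital_algebra_mat: "unital_algebra (mat_algebra TYPE('a::field) s)"
proof -
  interpret R: ring "ring_mat TYPE('a) s ()" by (rule ring_mat)
  interpret G: abelian_group "mat_algebra TYPE('a) s" by (rule abelian_group_mat)
  show ?thesis
    by unfold_locales
      (auto simp: module_mat_simps algebra_simps add_smult_distrib_right_mat add_smult_distrib_left_mat
         mult_smult_distrib add_mult_distrib_mat mult_add_distrib_mat)
qed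

locale pc_evaluation = unital_algebra A for A :: "('f::field, 'v) module" (structure) +
  fixes n :: nat and \<Omega> :: "nat set" and x u :: "nat \<Rightarrow> 'v"
  assumes x_closed: "i \<in> {1..n} \<Longrightarrow> x i \<in> carrier A"
    and u_closed: "\<omega> \<in> \<Omega> \<Longrightarrow> u \<omega> \<in> carrier A"
    and u_comm: "\<lbrakk>\<omega> \<in> \<Omega>; \<omega>' \<in> \<Omega>\<rbrakk> \<Longrightarrow> u \<omega> \<otimes> u \<omega>' = u \<omega>' \<otimes> u \<omega>"
begin

abbreviation good :: "pc_mon \<Rightarrow> bool" where
  "good w \<equiv> xvars w \<subseteq> {1..n} \<and> uvars w \<subseteq> \<Omega>"

lemma ev_umon_empty [simp]: "ev_umon A u {#} = \<one>"
  by (simp add: ev_umon_def)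

lemma foldr_closed:
  "set xs \<subseteq> \<Omega> \<Longrightarrow> foldr (\<lambda>\<omega> a. u \<omega> \<otimes> a) xs \<one> \<in> carrier A"
  by (induction xs) (auto intro: u_closed)

lemma foldr_insort:
  assumes "set xs \<subseteq> \<Omega>" "\<omega> \<in> \<Omega>"
  shows "foldr (\<lambda>\<omega> a. u \<omega> \<otimes> a) (insort \<omega> xs) \<one> = u \<omega> \<otimes> foldr (\<lambda>\<omega> a. u \<omega> \<otimes> a) xs \<one>"
  using assms
proof (induction xs)
  case (Cons y ys)
  have "u y \<otimes> (u \<omega> \<otimes> b) = u \<omega> \<otimes> (u y \<otimes> b)" if "b \<in> carrier A" for b
    using that Cons.prems u_comm[of y \<omega>] by (simp add: u_closed flip: m_assoc)
  then show ?case
    using Cons foldr_closed[of ys] by auto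
qed (auto intro: u_closed)

lemma ev_umon_closed: "set_mset M \<subseteq> \<Omega> \<Longrightarrow> ev_umon A u M \<in> carrier A"
  unfolding ev_umon_def by (rule foldr_closed) simp

lemma ev_umon_add_mset:
  "\<lbrakk>set_mset M \<subseteq> \<Omega>; \<omega> \<in> \<Omega>\<rbrakk> \<Longrightarrow> ev_umon A u (add_mset \<omega> M) = u \<omega> \<otimes> ev_umon A u M"
  unfolding ev_umon_def by (simp add: foldr_insort)

lemma ev_umon_add:
  "\<lbrakk>set_mset M \<subseteq> \<Omega>; set_mset N \<subseteq> \<Omega>\<rbrakk> \<Longrightarrow> ev_umon A u (M + N) = ev_umon A u M \<otimes> ev_umon A u N"
  by (induction M) (auto simp: ev_umon_add_mset ev_umon_closed u_closed m_assoc)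

lemma ev_mon_closed: "good w \<Longrightarrow> ev_mon A x u w \<in> carrier A"
  by (induction w) (auto intro!: m_closed ev_umon_closed x_closed)

lemma ev_mon_lmul:
  "\<lbrakk>set_mset M \<subseteq> \<Omega>; good w\<rbrakk> \<Longrightarrow> ev_mon A x u (pc_mon_lmul M w) = ev_umon A u M \<otimes> ev_mon A x u w"
  by (cases w) (auto simp: ev_umon_add ev_umon_closed ev_mon_closed x_closed m_assoc)

lemma ev_mon_add:
  "\<lbrakk>good v; good w\<rbrakk> \<Longrightarrow> ev_mon A x u (v + w) = ev_mon A x u v \<otimes> ev_mon A x u w"
  by (induction v) (auto simp: ev_mon_lmul ev_umon_closed ev_mon_closed x_closed m_assoc)

lemma good_add: "\<lbrakk>good v; good w\<rbrakk> \<Longrightarrow> good (v + w)"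
proof (induction v)
  case (UMon M)
  then show ?case by (cases w) auto
qed auto

lemma pc_ev_superset:
  assumes "finite S" "Poly_Mapping.keys f \<subseteq> S" "\<And>w. w \<in> S \<Longrightarrow> good w"
  shows "pc_ev A x u f = (\<Oplus>w\<in>S. Poly_Mapping.lookup f w \<odot> ev_mon A x u w)"
  unfolding pc_ev_def using assms
  by (intro add.finprod_mono_neutral_cong_left) (auto simp: ev_mon_closed in_keys_iff)

lemma pc_ev_closed: "f \<in> pc_polys n \<Omega> \<Longrightarrow> pc_ev A x u f \<in> carrier A"
  unfolding pc_ev_def pc_polys_def by (intro finsum_closed) (auto simp: ev_mon_closed)

lemma pc_ev_zero [simp]: "pc_ev A x u 0 = \<zero>"
  by (simp add: pc_ev_def)

lemma pc_ev_single:
  "good w \<Longrightarrow> pc_ev A x u (Poly_Mapping.single w c) = c \<odot> ev_mon A x u w"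
  by (subst pc_ev_superset[of "{w}"]) (auto simp: ev_mon_closed)

lemma pc_ev_X: "i \<in> {1..n} \<Longrightarrow> pc_ev A x u (pc_X i) = x i"
  using x_closed[of i] by (simp add: pc_X_def pc_ev_single)

lemma pc_ev_U: "\<omega> \<in> \<Omega> \<Longrightarrow> pc_ev A x u (pc_U \<omega>) = u \<omega>"
  using u_closed[of \<omega>] by (simp add: pc_U_def pc_ev_single ev_umon_add_mset)

lemma pc_ev_const: "pc_ev A x u (pc_const c) = c \<odot> \<one>"
  by (simp add: pc_const_def zero_pc_mon_def pc_ev_single)

lemma pc_ev_one: "pc_ev A x u 1 = \<one>"
  using pc_ev_const[of 1] by (simp add: pc_const_def)

lemma pc_ev_add:
  assumes "f \<in> pc_polys n \<Omega>" "g \<in> pc_polys n \<Omega>"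
  shows "pc_ev A x u (f + g) = pc_ev A x u f \<oplus> pc_ev A x u g"
proof -
  let ?S = "Poly_Mapping.keys f \<union> Poly_Mapping.keys g"
  have good: "good w" if "w \<in> ?S" for w
    using that assms by (auto simp: pc_polys_def)
  have "pc_ev A x u (f + g) = (\<Oplus>w\<in>?S. Poly_Mapping.lookup (f + g) w \<odot> ev_mon A x u w)"
    using Poly_Mapping.keys_add[of f g] good by (intro pc_ev_superset) auto
  also have "\<dots> = (\<Oplus>w\<in>?S. Poly_Mapping.lookup f w \<odot> ev_mon A x u w \<oplus> Poly_Mapping.lookup g w \<odot> ev_mon A x u w)"
    using good by (intro finsum_cong') (auto simp: lookup_add smult_l_distr ev_mon_closed)
  also have "\<dots> = (\<Oplus>w\<in>?S. Poly_Mapping.lookup f w \<odot> ev_mon A x u w) \<oplus> (\<Oplus>w\<in>?S. Poly_Mapping.lookup g w \<odot> ev_mon A x u w)"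
    using good by (intro finsum_addf) (auto simp: ev_mon_closed)
  also have "(\<Oplus>w\<in>?S. Poly_Mapping.lookup f w \<odot> ev_mon A x u w) = pc_ev A x u f"
    using good by (intro pc_ev_superset[symmetric]) auto
  also have "(\<Oplus>w\<in>?S. Poly_Mapping.lookup g w \<odot> ev_mon A x u w) = pc_ev A x u g"
    using good by (intro pc_ev_superset[symmetric]) auto
  finally show ?thesis .
qed

lemma pc_polys_add:
  "\<lbrakk>f \<in> pc_polys n \<Omega>; g \<in> pc_polys n \<Omega>\<rbrakk> \<Longrightarrow> f + g \<in> (pc_polys n \<Omega> :: 'f pc_poly set)"
  using Poly_Mapping.keys_add[of f g] by (fastforce simp: pc_polys_def)

lemma pc_polys_mult:
  assumes "f \<in> pc_polys n \<Omega>" "g \<in> pc_polys n \<Omega>"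
  shows "f * g \<in> (pc_polys n \<Omega> :: 'f pc_poly set)"
  unfolding pc_polys_def
proof safe
  fix w assume "w \<in> Poly_Mapping.keys (f * g)"
  then obtain v v' where "w = v + v'" "v \<in> Poly_Mapping.keys f" "v' \<in> Poly_Mapping.keys g"
    using Poly_Mapping.keys_mult[of f g] by auto
  hence "good w" using assms good_add by (simp add: pc_polys_def)
  thus "i \<in> xvars w \<Longrightarrow> i \<in> {1..n}" "i \<in> uvars w \<Longrightarrow> i \<in> \<Omega>" for i by blast+
qed

lemma pc_polys_single: "good w \<Longrightarrow> Poly_Mapping.single w c \<in> pc_polys n \<Omega>"
  by (auto simp: pc_polys_def)

lemma pc_polys_induct [consumes 1, case_names zero single_add]:
  assumes "f \<in> (pc_polys n \<Omega> :: 'f pc_poly set)" and "P 0"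
    and "\<And>w c g. \<lbrakk>good w; g \<in> pc_polys n \<Omega>; P g\<rbrakk> \<Longrightarrow> P (Poly_Mapping.single w c + g)"
  shows "P f"
  using assms(1)
proof (induction "card (Poly_Mapping.keys f)" arbitrary: f)
  case 0
  then show ?case using assms(2) by simp
next
  case (Suc k)
  then obtain w where w: "w \<in> Poly_Mapping.keys f" by fastforce
  define g where "g = f - Poly_Mapping.single w (Poly_Mapping.lookup f w)"
  have look: "Poly_Mapping.lookup g v = (if v = w then 0 else Poly_Mapping.lookup f v)" for v
    by (simp add: g_def lookup_minus lookup_single when_def)
  have keys: "Poly_Mapping.keys g = Poly_Mapping.keys f - {w}"
    by (auto simp: in_keys_iff look split: if_splits)
  have "P g"
    using Suc w by (intro Suc.hyps) (auto simp: keys pc_polys_def)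
  moreover have "g \<in> pc_polys n \<Omega>" "good w"
    using Suc.prems w by (auto simp: keys pc_polys_def)
  ultimately have "P (Poly_Mapping.single w (Poly_Mapping.lookup f w) + g)"
    by (intro assms(3)) auto
  thus ?case by (simp add: g_def)
qed

lemma pc_ev_mult_single:
  assumes "good v" "g \<in> pc_polys n \<Omega>"
  shows "pc_ev A x u (Poly_Mapping.single v c * g) = pc_ev A x u (Poly_Mapping.single v c) \<otimes> pc_ev A x u g"
  using assms(2)
proof (induction rule: pc_polys_induct)
  case zero
  then show ?case using assms(1) by (simp add: pc_ev_single ev_mon_closed)
next
  case (single_add w c' g)
  have "pc_ev A x u (Poly_Mapping.single v c * (Poly_Mapping.single w c' + g)) =
        pc_ev A x u (Poly_Mapping.single (v + w) (c * c')) \<oplus> pc_ev A x u (Poly_Mapping.single v c * g)"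
    unfolding distrib_left mult_single
    using assms(1) single_add good_add[of v w]
    by (intro pc_ev_add pc_polys_mult pc_polys_single) auto
  also have "pc_ev A x u (Poly_Mapping.single (v + w) (c * c')) =
        pc_ev A x u (Poly_Mapping.single v c) \<otimes> pc_ev A x u (Poly_Mapping.single w c')"
    using assms(1) single_add(1) good_add[of v w]
    by (simp add: pc_ev_single ev_mon_add ev_mon_closed smult_mult_l smult_mult_r
          mult.commute[of c] smult_assoc)
  finally show ?case
    using assms(1) single_add
    by (simp add: pc_ev_add pc_polys_single pc_ev_closed r_distr)
qed

lemma pc_ev_mult:
  assumes "f \<in> pc_polys n \<Omega>" "g \<in> pc_polys n \<Omega>"
  shows "pc_ev A x u (f * g) = pc_ev A x u f \<otimes> pc_ev A x u g"
  using assms(1)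
proof (induction rule: pc_polys_induct)
  case zero
  then show ?case using assms(2) by (simp add: pc_ev_closed)
next
  case (single_add w c f)
  then show ?case using assms(2)
    by (simp add: distrib_right pc_ev_add pc_polys_single pc_polys_mult pc_ev_mult_single
          pc_ev_closed l_distr)
qed

lemma pc_ev_unique:
  fixes \<phi> :: "'f pc_poly \<Rightarrow> 'v"
  assumes f: "f \<in> pc_polys n \<Omega>"
    and add: "\<And>f g. \<lbrakk>f \<in> pc_polys n \<Omega>; g \<in> pc_polys n \<Omega>\<rbrakk> \<Longrightarrow> \<phi> (f + g) = \<phi> f \<oplus> \<phi> g"
    and mult: "\<And>f g. \<lbrakk>f \<in> pc_polys n \<Omega>; g \<in> pc_polys n \<Omega>\<rbrakk> \<Longrightarrow> \<phi> (f * g) = \<phi> f \<otimes> \<phi> g"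
    and const: "\<And>c. \<phi> (pc_const c) = c \<odot> \<one>"
    and X: "\<And>i. i \<in> {1..n} \<Longrightarrow> \<phi> (pc_X i) = x i"
    and U: "\<And>\<omega>. \<omega> \<in> \<Omega> \<Longrightarrow> \<phi> (pc_U \<omega>) = u \<omega>"
  shows "\<phi> f = pc_ev A x u f"
proof -
  let ?s = "\<lambda>w. Poly_Mapping.single w (1::'f)"
  have umon: "\<phi> (?s (UMon M)) = ev_umon A u M" if "set_mset M \<subseteq> \<Omega>" for M
    using that
  proof (induction M)
    case empty
    then show ?case using const[of 1] by (simp add: pc_const_def zero_pc_mon_def)
  next
    case (add \<omega> M)
    have "?s (UMon (add_mset \<omega> M)) = pc_U \<omega> * ?s (UMon M)"
      by (simp add: pc_U_def mult_single)
    then show ?case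
      using add U[of \<omega>] by (simp add: mult pc_polys_single pc_U_def ev_umon_add_mset)
  qed
  have mon: "\<phi> (?s w) = ev_mon A x u w" if "good w" for w
    using that
  proof (induction w)
    case (UMon M)
    then show ?case using umon by simp
  next
    case (UXMon M i w)
    have "?s (UXMon M i w) = ?s (UMon M) * (pc_X i * ?s w)"
      by (cases w) (simp_all add: pc_X_def mult_single)
    moreover have "pc_X i \<in> (pc_polys n \<Omega> :: 'f pc_poly set)"
      using UXMon.prems by (simp add: pc_X_def pc_polys_single)
    moreover have "?s (UMon M) \<in> pc_polys n \<Omega>" "?s w \<in> pc_polys n \<Omega>"
      using UXMon.prems by (auto intro!: pc_polys_single)
    ultimately show ?case
      using UXMon X[of i] umon[of M] by (simp add: mult pc_polys_mult)
  qed
  have const_poly: "pc_const c \<in> pc_polys n \<Omega>" for c :: 'f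
    by (simp add: pc_const_def pc_polys_single zero_pc_mon_def)
  have single: "\<phi> (Poly_Mapping.single w c) = pc_ev A x u (Poly_Mapping.single w c)" if "good w" for w c
  proof -
    have "Poly_Mapping.single w c = pc_const c * ?s w"
      by (simp add: pc_const_def mult_single)
    hence "\<phi> (Poly_Mapping.single w c) = (c \<odot> \<one>) \<otimes> ev_mon A x u w"
      using that by (simp add: mult const_poly pc_polys_single const mon)
    thus ?thesis
      using that by (simp add: pc_ev_single smult_mult_l ev_mon_closed)
  qed
  from f show ?thesis
  proof (induction rule: pc_polys_induct)
    case zero
    then show ?case using const[of 0] by (simp add: pc_const_def)
  next
    case (single_add w c g)
    then show ?case using single by (simp add: add pc_ev_add pc_polys_single)
  qed
qed

end

end

theory Submission
  imports Defs "Jordan_Normal_Form.Determinant" "HOL-Number_Theory.Cong"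
begin

text \<open>Divide the matrices into \<open>(d + 1) \<times> (d + 1)\<close> blocks of size \<open>n\<close>. Let the \<open>u\<^sub>\<omega>\<close> be diagonal
  and all \<open>x\<^sub>j\<close> but one be block diagonal with weighted cyclic shifts as blocks. The value of \<open>f\<close>
  is then a linear function of the remaining variable \<open>x\<^sub>c = Y\<close> which maps each block
  \<open>Y\<^sub>p\<^sub>q\<close> to a block in the same place. Here \<open>c\<close> is chosen as the first variable of some monomial of \<open>f\<close>.

  For \<open>p \<noteq> q\<close> this map on blocks is bijective for generic parameters: if those of block \<open>p\<close> vanish,
  only the monomials that begin with \<open>X\<^sub>c\<close> survive, and the map becomes right multiplication by a
  diagonal matrix times a power of the cyclic shift, where the diagonal entries are nonzero polynomials in the
  parameters of block \<open>q\<close>, as the entries and differences met along a cyclic shift are independent.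
  Hence the image of \<open>f\<close> contains every matrix whose diagonal blocks vanish. It is closed under
  conjugation, and a trace zero matrix with an additional zero row and column is similar to a
  matrix with zero diagonal.\<close>

section \<open>Functions that are polynomial along lines\<close>

text \<open>Stands in for polynomial functions of many variables: joining two points by a line
  reduces every genericity argument to univariate polynomials.\<close>

definition line_poly :: "(('v \<Rightarrow> 'F::field) \<Rightarrow> 'F) \<Rightarrow> bool" where
  "line_poly \<phi> \<longleftrightarrow>
     (\<forall>z z'. \<exists>p. \<forall>t. \<phi> (\<lambda>v. z v + t * (z' v - z v)) = poly p t)"

lemma line_poly_const [simp]: "line_poly (\<lambda>z. c)"
  unfolding line_poly_def by (intro allI exI[of _ "[:c:]"]) simp

lemma line_poly_coord [simp]: "line_poly (\<lambda>z. z v)"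
  unfolding line_poly_def
proof (intro allI)
  fix z z' :: "'a \<Rightarrow> 'b"
  show "\<exists>p. \<forall>t. z v + t * (z' v - z v) = poly p t"
    by (rule exI[of _ "[:z v, z' v - z v:]"]) simp
qed

lemma line_poly_binop:
  assumes "line_poly \<phi>" "line_poly \<psi>"
    and "\<And>p q t. g (poly p t) (poly q t) = poly (h p q) t"
  shows "line_poly (\<lambda>z. g (\<phi> z) (\<psi> z))"
  using assms unfolding line_poly_def by metis

lemma line_poly_add: "line_poly \<phi> \<Longrightarrow> line_poly \<psi> \<Longrightarrow> line_poly (\<lambda>z. \<phi> z + \<psi> z)"
  by (rule line_poly_binop[where h = "(+)"]) simp_all

lemma line_poly_diff: "line_poly \<phi> \<Longrightarrow> line_poly \<psi> \<Longrightarrow> line_poly (\<lambda>z. \<phi> z - \<psi> z)"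
  by (rule line_poly_binop[where h = "(-)"]) simp_all

lemma line_poly_mult: "line_poly \<phi> \<Longrightarrow> line_poly \<psi> \<Longrightarrow> line_poly (\<lambda>z. \<phi> z * \<psi> z)"
  by (rule line_poly_binop[where h = "(*)"]) simp_all

lemma line_poly_sum:
  "(\<And>i. i \<in> I \<Longrightarrow> line_poly (\<phi> i)) \<Longrightarrow> line_poly (\<lambda>z. \<Sum>i\<in>I. \<phi> i z)"
  by (induction I rule: infinite_finite_induct) (auto intro: line_poly_add)

lemma line_poly_prod:
  "(\<And>i. i \<in> I \<Longrightarrow> line_poly (\<phi> i)) \<Longrightarrow> line_poly (\<lambda>z. \<Prod>i\<in>I. \<phi> i z)"
  by (induction I rule: infinite_finite_induct) (auto intro: line_poly_mult)

lemmas line_poly_intros =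
  line_poly_const line_poly_coord line_poly_add line_poly_diff line_poly_mult
  line_poly_sum line_poly_prod

text \<open>On the line through \<open>z\<close> and \<open>z'\<close> both functions restrict to
  nonzero univariate polynomials. Their product has finitely many roots, and an infinite field
  offers a parameter outside them.\<close>

lemma line_poly_mult_nonzero:
  fixes \<phi> \<psi> :: "('v \<Rightarrow> 'F::field) \<Rightarrow> 'F"
  assumes inf: "infinite (UNIV :: 'F set)"
    and "line_poly \<phi>" "line_poly \<psi>" "\<phi> z \<noteq> 0" "\<psi> z' \<noteq> 0"
  obtains y where "\<phi> y * \<psi> y \<noteq> 0"
proof -
  define l where "l t = (\<lambda>v. z v + t * (z' v - z v))" for t
  obtain p q where p: "\<And>t. \<phi> (l t) = poly p t" and q: "\<And>t. \<psi> (l t) = poly q t"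
    using assms(2,3) unfolding line_poly_def l_def by metis
  have "l 0 = z" "l 1 = z'" by (auto simp: l_def)
  hence "poly p 0 \<noteq> 0" "poly q 1 \<noteq> 0" using assms p q by metis+
  hence "p * q \<noteq> 0" by auto
  hence "finite {t. poly (p * q) t = 0}" by (rule poly_roots_finite)
  hence "{t. poly (p * q) t = 0} \<noteq> UNIV" using inf by metis
  then obtain t where "poly (p * q) t \<noteq> 0" by blast
  with p q that[of "l t"] show thesis by simp
qed

text \<open>The source of all generic choices below: the two-function case, applied to partial
  products, merges finitely many conditions into one.\<close>

lemma line_poly_common_nonzero:
  fixes \<phi> :: "'k \<Rightarrow> ('v \<Rightarrow> 'F::field) \<Rightarrow> 'F"
  assumes inf: "infinite (UNIV :: 'F set)" and "finite K"
    and "\<And>k. k \<in> K \<Longrightarrow> line_poly (\<phi> k)" and "\<And>k. k \<in> K \<Longrightarrow> \<exists>z. \<phi> k z \<noteq> 0"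
  obtains z where "\<And>k. k \<in> K \<Longrightarrow> \<phi> k z \<noteq> 0"
proof -
  have "\<exists>z. (\<Prod>k\<in>K. \<phi> k z) \<noteq> 0"
    using assms(2-)
  proof (induction K)
    case (insert k K)
    then obtain z z' where "(\<Prod>k\<in>K. \<phi> k z) \<noteq> 0" "\<phi> k z' \<noteq> 0" by blast
    moreover have "line_poly (\<phi> k)" "line_poly (\<lambda>z. \<Prod>k\<in>K. \<phi> k z)"
      using insert.prems(1) by (auto intro: line_poly_prod)
    ultimately obtain y where "\<phi> k y * (\<Prod>k\<in>K. \<phi> k y) \<noteq> 0"
      by - (rule line_poly_mult_nonzero[OF inf, of "\<phi> k" "\<lambda>z. \<Prod>k\<in>K. \<phi> k z" z' z], assumption+)
    then show ?case using insert.hyps by auto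
  qed auto
  then show thesis using that \<open>finite K\<close> by auto
qed

section \<open>Solvability of square linear systems as a polynomial condition\<close>

definition solvable_system :: "'j set \<Rightarrow> ('j \<Rightarrow> 'j \<Rightarrow> 'F::field) \<Rightarrow> bool" where
  "solvable_system J M \<longleftrightarrow> (\<forall>b. \<exists>y. \<forall>i\<in>J. (\<Sum>j\<in>J. M i j * y j) = b i)"

text \<open>Solutions for the unit vectors form a right inverse, and an inverse matrix yields all
  solutions; \<open>e\<close> only transports the unordered index set to
  \<open>{..<m}\<close>.\<close>

lemma solvable_system_iff_det:
  fixes M :: "'j \<Rightarrow> 'j \<Rightarrow> 'F::field"
  assumes e: "bij_betw e {..<m} J"
  shows "solvable_system J M \<longleftrightarrow> det (mat m m (\<lambda>(k, l). M (e k) (e l))) \<noteq> 0"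
proof
  define A where "A = mat m m (\<lambda>(k, l). M (e k) (e l))"
  have A: "A \<in> carrier_mat m m" by (simp add: A_def)
  have J: "J = e ` {..<m}" and inj: "inj_on e {..<m}" using e by (auto simp: bij_betw_def)
  have sum_J: "(\<Sum>j\<in>J. g j) = (\<Sum>l<m. g (e l))" for g :: "'j \<Rightarrow> 'F"
    unfolding J using inj by (simp add: sum.reindex)
  {
    assume "solvable_system J M"
    then obtain y where y: "\<And>b i. i \<in> J \<Longrightarrow> (\<Sum>j\<in>J. M i j * y b j) = b i"
      unfolding solvable_system_def by metis
    \<comment> \<open>Column \<open>k\<close> is a solution for the unit vector at
      \<open>e k\<close>.\<close>
    define C where "C = mat m m (\<lambda>(l, k). y (\<lambda>i. if i = e k then 1 else 0) (e l))"
    have "A * C = 1\<^sub>m m"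
    proof (rule eq_matI)
      fix i k assume "i < dim_row (1\<^sub>m m :: 'F mat)" "k < dim_col (1\<^sub>m m :: 'F mat)"
      hence ik: "i < m" "k < m" by auto
      have "(A * C) $$ (i, k) = (\<Sum>j\<in>J. M (e i) j * y (\<lambda>i. if i = e k then 1 else 0) j)"
        using ik by (simp add: A_def C_def scalar_prod_def sum_J atLeast0LessThan)
      also have "\<dots> = (if e i = e k then 1 else 0)"
        using y[of "e i"] ik J by auto
      also have "\<dots> = 1\<^sub>m m $$ (i, k)"
        using inj ik by (auto simp: inj_on_def)
      finally show "(A * C) $$ (i, k) = 1\<^sub>m m $$ (i, k)" .
    qed (auto simp: A_def C_def)
    moreover have "det (A * C) = det A * det C"
      by (rule det_mult) (auto simp: A_def C_def)
    ultimately show "det A \<noteq> 0" by auto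
  next
    assume "det A \<noteq> 0"
    from det_non_zero_imp_unit[OF A this, of "()"]
    obtain C where C: "C \<in> carrier_mat m m" and AC: "A * C = 1\<^sub>m m"
      by (auto simp: Units_def ring_mat_def)
    show "solvable_system J M"
      unfolding solvable_system_def
    proof
      fix b :: "'j \<Rightarrow> 'F"
      define v where "v = vec m (\<lambda>k. b (e k))"
      define y where "y j = (C *\<^sub>v v) $ (the_inv_into {..<m} e j)" for j
      have v: "v \<in> carrier_vec m" by (simp add: v_def)
      have y_e: "y (e l) = (C *\<^sub>v v) $ l" if "l < m" for l
        using that inj by (simp add: y_def the_inv_into_f_f)
      have "A *\<^sub>v (C *\<^sub>v v) = v"
        using A C v AC by (metis assoc_mult_mat_vec one_mult_mat_vec)
      moreover have "(A *\<^sub>v (C *\<^sub>v v)) $ k = (\<Sum>j\<in>J. M (e k) j * y j)" if "k < m" for k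
        using that A C by (simp add: sum_J y_e A_def scalar_prod_def atLeast0LessThan)
      ultimately have "(\<Sum>j\<in>J. M (e k) j * y j) = b (e k)" if "k < m" for k
        using that by (metis index_vec v_def)
      thus "\<exists>y. \<forall>i\<in>J. (\<Sum>j\<in>J. M i j * y j) = b i"
        using J by auto
    qed
  }
qed

text \<open>By the Leibniz formula the determinant is polynomial along lines as soon as the entries
  are; it serves as \<open>\<Delta>\<close>.\<close>

lemma solvable_system_line_poly:
  fixes M :: "('v \<Rightarrow> 'F::field) \<Rightarrow> 'j \<Rightarrow> 'j \<Rightarrow> 'F"
  assumes "finite J" and M: "\<And>i j. line_poly (\<lambda>z. M z i j)"
  obtains \<Delta> where "line_poly \<Delta>" "\<And>z. \<Delta> z \<noteq> 0 \<longleftrightarrow> solvable_system J (M z)"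
proof -
  obtain e where e: "bij_betw e {..<card J} J"
    using ex_bij_betw_nat_finite[OF \<open>finite J\<close>] by (auto simp: atLeast0LessThan)
  let ?A = "\<lambda>z. mat (card J) (card J) (\<lambda>(k, l). M z (e k) (e l))"
  have "?A z $$ (k, p k) = M z (e k) (e (p k))"
    if "p permutes {0..<card J}" "k \<in> {0..<card J}" for z p k
    using permutes_in_image[OF that(1)] that(2) by simp
  hence "det (?A z) = (\<Sum>p | p permutes {0..<card J}.
      signof p * (\<Prod>k\<in>{0..<card J}. M z (e k) (e (p k))))" for z
    unfolding det_def by (auto intro!: sum.cong prod.cong)
  hence "line_poly (\<lambda>z. det (?A z))"
    by (auto intro!: line_poly_intros M)
  moreover have "det (?A z) \<noteq> 0 \<longleftrightarrow> solvable_system J (M z)" for z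
    using solvable_system_iff_det[OF e] by blast
  ultimately show thesis using that by blast
qed

section \<open>Conjugation to zero diagonal\<close>

text \<open>The matrix 1 + v w^T. It is inverted below only for w^T v = 0, when negating
  \<open>v\<close> gives the inverse.\<close>

definition transvection :: "nat \<Rightarrow> (nat \<Rightarrow> 'a::comm_ring_1) \<Rightarrow> (nat \<Rightarrow> 'a) \<Rightarrow> 'a mat" where
  "transvection s v w = mat s s (\<lambda>(i, j). (if i = j then 1 else 0) + v i * w j)"

lemma transvection_carrier [simp]: "transvection s v w \<in> carrier_mat s s"
  by (simp add: transvection_def)

lemma transvection_mult_left:
  assumes "A \<in> carrier_mat s m" "i < s" "j < m"
  shows "(transvection s v w * A) $$ (i, j) = A $$ (i, j) + v i * (\<Sum>k<s. w k * A $$ (k, j))"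
proof -
  have "(transvection s v w * A) $$ (i, j)
      = (\<Sum>k<s. ((if i = k then 1 else 0) + v i * w k) * A $$ (k, j))"
    using assms by (simp add: transvection_def scalar_prod_def atLeast0LessThan)
  also have "\<dots> = (\<Sum>k<s. (if i = k then A $$ (k, j) else 0)) + (\<Sum>k<s. v i * (w k * A $$ (k, j)))"
    by (simp add: distrib_right sum.distrib if_distrib[of "\<lambda>x. x * _"] mult.assoc cong: if_cong)
  finally show ?thesis using assms by (simp add: sum_distrib_left)
qed

lemma transvection_mult_right:
  assumes "A \<in> carrier_mat m s" "i < m" "j < s"
  shows "(A * transvection s v w) $$ (i, j) = A $$ (i, j) + (\<Sum>k<s. A $$ (i, k) * v k) * w j"
proof -
  have "(A * transvection s v w) $$ (i, j)
      = (\<Sum>k<s. A $$ (i, k) * ((if k = j then 1 else 0) + v k * w j))"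
    using assms by (simp add: transvection_def scalar_prod_def atLeast0LessThan)
  also have "\<dots> = (\<Sum>k<s. (if k = j then A $$ (i, k) else 0)) + (\<Sum>k<s. A $$ (i, k) * v k * w j)"
    by (simp add: distrib_left sum.distrib if_distrib[of "\<lambda>x. _ * x"] mult.assoc cong: if_cong)
  finally show ?thesis using assms by (simp add: sum_distrib_right)
qed

lemma transvection_inverse:
  assumes "(\<Sum>k<s. w k * v k) = 0"
  shows "transvection s v w * transvection s (\<lambda>i. - v i) w = 1\<^sub>m s"
proof (rule eq_matI)
  fix i j assume "i < dim_row (1\<^sub>m s :: 'a mat)" "j < dim_col (1\<^sub>m s :: 'a mat)"
  hence ij: "i < s" "j < s" by auto
  have "(\<Sum>k<s. w k * ((if k = j then 1 else 0) - v k * w j)) = w j - (\<Sum>k<s. w k * v k) * w j"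
    using ij by (simp add: algebra_simps sum_subtractf sum_distrib_left if_distrib[of "\<lambda>x. _ * x"] cong: if_cong)
  with ij assms show "(transvection s v w * transvection s (\<lambda>i. - v i) w) $$ (i, j) = 1\<^sub>m s $$ (i, j)"
    by (simp add: transvection_mult_left[OF transvection_carrier]) (simp add: transvection_def)
qed (auto simp: transvection_def)

text \<open>\<open>B\<close> is the expansion of (1 + v w^T) A (1 - v w^T), where \<open>wA\<close>
  is the row vector w^T A.\<close>

lemma similar_mat_transvection:
  fixes A :: "'a::comm_ring_1 mat"
  assumes A: "A \<in> carrier_mat s s" and wv: "(\<Sum>k<s. w k * v k) = 0"
  defines "wA \<equiv> \<lambda>j. \<Sum>k<s. w k * A $$ (k, j)"
  defines "B \<equiv> mat s s (\<lambda>(i, j). A $$ (i, j) + v i * wA j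
    - (\<Sum>k<s. A $$ (i, k) * v k) * w j - v i * (\<Sum>k<s. wA k * v k) * w j)"
  shows "similar_mat A B"
proof -
  let ?P = "transvection s v w" and ?Q = "transvection s (\<lambda>i. - v i) w"
  have "?P * ?Q = 1\<^sub>m s" "?Q * ?P = 1\<^sub>m s"
    using transvection_inverse[OF wv] transvection_inverse[of w "\<lambda>i. - v i" s] wv
    by (simp_all add: sum_negf)
  moreover have "B = ?P * A * ?Q"
  proof (rule eq_matI)
    fix i j assume "i < dim_row (?P * A * ?Q)" "j < dim_col (?P * A * ?Q)"
    hence ij: "i < s" "j < s" by (auto simp: transvection_def)
    have "(?P * A * ?Q) $$ (i, j) = (?P * A) $$ (i, j) + (\<Sum>k<s. (?P * A) $$ (i, k) * - v k) * w j"
      by (rule transvection_mult_right[OF mult_carrier_mat[OF transvection_carrier A] ij])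
    also have "\<dots> = A $$ (i, j) + v i * wA j + (\<Sum>k<s. (A $$ (i, k) + v i * wA k) * - v k) * w j"
      using ij A by (simp add: transvection_mult_left wA_def)
    also have "(\<Sum>k<s. (A $$ (i, k) + v i * wA k) * - v k)
        = - (\<Sum>k<s. A $$ (i, k) * v k) - v i * (\<Sum>k<s. wA k * v k)"
      by (simp add: algebra_simps sum.distrib sum_negf sum_subtractf sum_distrib_left)
    finally show "B $$ (i, j) = (?P * A * ?Q) $$ (i, j)"
      using ij by (simp add: B_def algebra_simps)
  qed (auto simp: B_def transvection_def)
  moreover have "B \<in> carrier_mat s s" by (simp add: B_def)
  ultimately have "similar_mat B A"
    using A by (intro similar_matI[of _ _ ?P ?Q s]) auto
  thus ?thesis by (rule similar_mat_sym)
qed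

lemma embed_mat_carrier:
  "B \<in> carrier_mat d d \<Longrightarrow> d \<le> s \<Longrightarrow> embed_mat d s B \<in> carrier_mat s s"
  unfolding embed_mat_def carrier_mat_def by simp

lemma embed_mat_index:
  assumes "B \<in> carrier_mat d d" "d \<le> s" "i < s" "j < s"
  shows "embed_mat d s B $$ (i, j) = (if i < d \<and> j < d then B $$ (i, j) else 0)"
  using assms by (auto simp: embed_mat_def)

text \<open>The spare index \<open>d\<close> makes this simpler than Fillmore's theorem: a first transvection fills row
  \<open>d\<close> with suitable nonzero entries, against which a second one clears the diagonal.\<close>

lemma embed_mat_similar_zero_diag:
  fixes B :: "'F::field mat"
  assumes inf: "infinite (UNIV :: 'F set)" and B: "B \<in> sl_mat d" and "d < s"
  obtains Z where "similar_mat (embed_mat d s B) Z" "Z \<in> carrier_mat s s"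
    "\<And>i. i < s \<Longrightarrow> Z $$ (i, i) = 0"
    "\<And>i j. i < s \<Longrightarrow> j < s \<Longrightarrow> \<not> (i \<le> d \<and> j \<le> d) \<Longrightarrow> Z $$ (i, j) = 0"
proof -
  have Bc: "B \<in> carrier_mat d d" and tr: "(\<Sum>i<d. B $$ (i, i)) = 0"
    using B by (auto simp: sl_mat_def mat_trace_def)
  let ?A = "embed_mat d s B"
  have A: "?A \<in> carrier_mat s s" using embed_mat_carrier[OF Bc] \<open>d < s\<close> by simp
  have Aij: "?A $$ (i, j) = (if i < d \<and> j < d then B $$ (i, j) else 0)" if "i < s" "j < s" for i j
    using embed_mat_index[OF Bc _ that] \<open>d < s\<close> by simp
  have sum_s: "(\<Sum>k<s. if k < d then g k else 0) = (\<Sum>k<d. g k)" for g :: "nat \<Rightarrow> 'F"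
  proof -
    have "{..<s} \<inter> {k. k < d} = {..<d}" using \<open>d < s\<close> by auto
    thus ?thesis by (simp add: sum.If_cases)
  qed
  have sum_d: "(\<Sum>k<s. if k = d then g k else 0) = g d" for g :: "nat \<Rightarrow> 'F"
    using \<open>d < s\<close> by simp
  \<comment> \<open>A generic combination of the rows of \<open>B\<close> is nonzero in every column
    whose diagonal entry has to be cleared; the unit vector at \<open>i\<close> witnesses each
    single condition.\<close>
  obtain \<beta> where \<beta>: "\<And>i. i \<in> {i. i < d \<and> B $$ (i, i) \<noteq> 0} \<Longrightarrow> (\<Sum>k<d. \<beta> k * B $$ (k, i)) \<noteq> 0"
  proof (rule line_poly_common_nonzero[OF inf, of "{i. i < d \<and> B $$ (i, i) \<noteq> 0}"
        "\<lambda>i \<beta>. \<Sum>k<d. \<beta> k * B $$ (k, i)"])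
    fix i assume "i \<in> {i. i < d \<and> B $$ (i, i) \<noteq> 0}"
    moreover from this have "(\<Sum>k<d. (if k = i then 1 else 0) * B $$ (k, i)) = B $$ (i, i)"
      by (simp add: if_distrib[of "\<lambda>x. x * _"] cong: if_cong)
    ultimately show "\<exists>\<beta>. (\<Sum>k<d. \<beta> k * B $$ (k, i)) \<noteq> 0"
      by (intro exI[of _ "\<lambda>k. if k = i then 1 else 0"]) simp
  qed (auto intro!: line_poly_intros)
  \<comment> \<open>\<open>\<rho>\<close> is the row to be planted at index \<open>d\<close>, and
    \<open>\<alpha>\<close> is scaled so that adding \<open>\<alpha> i * \<rho> i\<close> cancels
    the diagonal entry. Where \<open>B $$ (i, i) = 0\<close>, the quotient is 0 whatever
    \<open>\<rho> i\<close> is.\<close>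
  define \<rho> where "\<rho> i = (if i < d then \<Sum>k<d. \<beta> k * B $$ (k, i) else 0)" for i
  define \<alpha> where "\<alpha> i = (if i < d then - B $$ (i, i) / \<rho> i else 0)" for i
  have \<alpha>\<rho>: "\<alpha> i * \<rho> i = - B $$ (i, i)" if "i < d" for i
    using \<beta>[of i] that by (auto simp: \<alpha>_def \<rho>_def)
  define e where "e i = (if i = d then 1 else 0 :: 'F)" for i
  define \<beta>' where "\<beta>' i = (if i < d then \<beta> i else 0)" for i
  \<comment> \<open>Conjugation by 1 + e \<beta>'^T. Column \<open>d\<close> of the embedded matrix
    is zero, so only row \<open>d\<close> changes.\<close>
  define A1 where "A1 = mat s s (\<lambda>(i, j). ?A $$ (i, j) + e i * \<rho> j)"
  \<comment> \<open>Conjugation by 1 + \<alpha> e^T: it adds \<open>\<alpha> i\<close> times the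
    planted row to row \<open>i\<close>, and the compensating column operation touches only column
    \<open>d\<close>.\<close>
  define Z where "Z = mat s s (\<lambda>(i, j). A1 $$ (i, j) + \<alpha> i * \<rho> j
    - (\<Sum>k<s. A1 $$ (i, k) * \<alpha> k) * e j - \<alpha> i * (\<Sum>k<s. \<rho> k * \<alpha> k) * e j)"
  have "similar_mat ?A A1"
  proof -
    have "(\<Sum>k<s. \<beta>' k * e k) = 0"
      by (simp add: e_def \<beta>'_def if_distrib[of "\<lambda>x. _ * x"] sum_d cong: if_cong)
    note sim = similar_mat_transvection[OF A this]
    have \<rho>: "(\<Sum>k<s. \<beta>' k * ?A $$ (k, j)) = \<rho> j" if "j < s" for j
    proof -
      have "(\<Sum>k<s. \<beta>' k * ?A $$ (k, j)) = (\<Sum>k<s. if k < d then (if j < d then \<beta> k * B $$ (k, j) else 0) else 0)"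
        using that by (intro sum.cong) (auto simp: \<beta>'_def Aij)
      thus ?thesis by (simp add: sum_s \<rho>_def)
    qed
    have col: "(\<Sum>k<s. ?A $$ (i, k) * e k) = 0" if "i < s" for i
      using that by (intro sum.neutral) (auto simp: e_def Aij)
    have row: "(\<Sum>k<s. (\<Sum>l<s. \<beta>' l * ?A $$ (l, k)) * e k) = 0"
      by (intro sum.neutral) (auto simp: \<rho> e_def \<rho>_def)
    have "A1 = mat s s (\<lambda>(i, j). ?A $$ (i, j) + e i * (\<Sum>k<s. \<beta>' k * ?A $$ (k, j))
      - (\<Sum>k<s. ?A $$ (i, k) * e k) * \<beta>' j - e i * (\<Sum>k<s. (\<Sum>l<s. \<beta>' l * ?A $$ (l, k)) * e k) * \<beta>' j)"
      unfolding A1_def row by (intro cong_mat) (simp_all add: \<rho> col)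
    with sim show ?thesis by simp
  qed
  moreover have "similar_mat A1 Z"
  proof -
    have A1: "A1 \<in> carrier_mat s s" by (simp add: A1_def)
    have "(\<Sum>k<s. e k * \<alpha> k) = 0"
      by (simp add: e_def \<alpha>_def if_distrib[of "\<lambda>x. x * _"] sum_d cong: if_cong)
    note sim = similar_mat_transvection[OF A1 this]
    have \<rho>: "(\<Sum>k<s. e k * A1 $$ (k, j)) = \<rho> j" if "j < s" for j
      using that \<open>d < s\<close>
      by (simp add: e_def A1_def if_distrib[of "\<lambda>x. x * _"] sum_d Aij cong: if_cong)
    have "Z = mat s s (\<lambda>(i, j). A1 $$ (i, j) + \<alpha> i * (\<Sum>k<s. e k * A1 $$ (k, j))
      - (\<Sum>k<s. A1 $$ (i, k) * \<alpha> k) * e j - \<alpha> i * (\<Sum>k<s. (\<Sum>l<s. e l * A1 $$ (l, k)) * \<alpha> k) * e j)"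
      unfolding Z_def by (intro cong_mat) (simp_all add: \<rho>)
    with sim show ?thesis by simp
  qed
  ultimately have "similar_mat ?A Z" by (rule similar_mat_trans)
  moreover have "Z $$ (i, i) = 0" if "i < s" for i
  proof (cases "i = d")
    case True
    \<comment> \<open>The entry at \<open>(d, d)\<close> becomes minus this sum, that is, the trace
      of \<open>B\<close>.\<close>
    have "(\<Sum>k<s. A1 $$ (d, k) * \<alpha> k) = (\<Sum>k<s. if k < d then - B $$ (k, k) else 0)"
    proof (intro sum.cong refl)
      fix k assume "k \<in> {..<s}"
      hence "A1 $$ (d, k) = \<rho> k" using \<open>d < s\<close> by (simp add: A1_def Aij e_def)
      thus "A1 $$ (d, k) * \<alpha> k = (if k < d then - B $$ (k, k) else 0)"
        using \<alpha>\<rho>[of k] by (auto simp: mult.commute \<alpha>_def)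
    qed
    also have "\<dots> = 0" using tr by (simp add: sum_s sum_negf)
    finally show ?thesis
      using True \<open>d < s\<close> by (simp add: Z_def A1_def Aij e_def \<rho>_def \<alpha>_def[of d])
  next
    case False
    then show ?thesis
      using that \<alpha>\<rho>[of i] by (auto simp: Z_def A1_def Aij e_def \<alpha>_def[of i])
  qed
  moreover have "Z $$ (i, j) = 0" if ij: "i < s" "j < s" "\<not> (i \<le> d \<and> j \<le> d)" for i j
  proof -
    have "(\<Sum>k<s. A1 $$ (i, k) * \<alpha> k) = 0" if "d < i"
      using that ij by (intro sum.neutral) (auto simp: A1_def Aij e_def)
    thus ?thesis using ij by (auto simp: Z_def A1_def Aij e_def \<rho>_def \<alpha>_def)
  qed
  ultimately show thesis using that[of Z] by (auto simp: Z_def)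
qed

text \<open>Conjugation is an algebra automorphism. By uniqueness of the evaluation homomorphism it
  carries the value of \<open>f\<close> at \<open>x\<close>, \<open>u\<close> to the value at the
  conjugated arguments, and the conjugated \<open>u\<close> still commute.\<close>

lemma pc_image_conj:
  fixes f :: "'F::field pc_poly"
  assumes f: "f \<in> pc_polys n \<Omega>" and Z: "Z \<in> pc_image (mat_algebra TYPE('F) s) n \<Omega> f"
    and Zc: "Z \<in> carrier_mat s s" and sim: "similar_mat B Z"
  shows "B \<in> pc_image (mat_algebra TYPE('F) s) n \<Omega> f"
proof -
  let ?A = "mat_algebra TYPE('F) s"
  obtain P Q where PQ: "P \<in> carrier_mat s s" "Q \<in> carrier_mat s s" "P * Q = 1\<^sub>m s" "Q * P = 1\<^sub>m s"
    and B: "B = P * Z * Q"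
  proof -
    obtain P Q where "similar_mat_wit Z B Q P"
      using sim similar_mat_sym unfolding similar_mat_def by blast
    from similar_mat_witD2[OF Zc this] similar_mat_witD2(3)[OF _ similar_mat_wit_sym[OF this]]
    show thesis using that by blast
  qed
  obtain x u where Zxu: "Z = pc_ev ?A x u f"
    and x: "\<forall>i\<in>{1..n}. x i \<in> carrier_mat s s" and u: "\<forall>\<omega>\<in>\<Omega>. u \<omega> \<in> carrier_mat s s"
    and comm: "\<forall>\<omega>\<in>\<Omega>. \<forall>\<omega>'\<in>\<Omega>. u \<omega> * u \<omega>' = u \<omega>' * u \<omega>"
    using Z unfolding pc_image_def module_mat_simps by blast
  define c where "c M = P * M * Q" for M :: "'F mat"
  have c_mult: "c (M * N) = c M * c N" if "M \<in> carrier_mat s s" "N \<in> carrier_mat s s" for M N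
  proof -
    have "c M * c N = P * M * (Q * P) * N * Q"
      unfolding c_def using that PQ(1,2)
      by (simp add: assoc_mult_mat[of _ s s _ s _ s])
    thus ?thesis unfolding PQ(4) c_def using that PQ(1,2)
      by (simp add: assoc_mult_mat[of _ s s _ s _ s])
  qed
  have c_add: "c (M + N) = c M + c N" if "M \<in> carrier_mat s s" "N \<in> carrier_mat s s" for M N
    using that PQ(1,2)
    by (simp add: c_def mult_add_distrib_mat[of P s s M s N]
        add_mult_distrib_mat[of "P * M" s s "P * N" Q s])
  have c_carrier: "c M \<in> carrier_mat s s" if "M \<in> carrier_mat s s" for M
    using that PQ by (auto simp: c_def)
  interpret U: unital_algebra ?A by (rule unital_algebra_mat)
  interpret E: pc_evaluation ?A n \<Omega> x u
    by unfold_locales (use x u comm in \<open>auto simp: module_mat_simps\<close>)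
  interpret E': pc_evaluation ?A n \<Omega> "\<lambda>i. c (x i)" "\<lambda>\<omega>. c (u \<omega>)"
    by unfold_locales (use x u comm in \<open>auto simp: module_mat_simps c_carrier simp flip: c_mult\<close>)
  have closed: "pc_ev ?A x u g \<in> carrier_mat s s" if "g \<in> pc_polys n \<Omega>" for g
    using E.pc_ev_closed[OF that] by (simp add: module_mat_simps)
  have "c (pc_ev ?A x u f) = pc_ev ?A (\<lambda>i. c (x i)) (\<lambda>\<omega>. c (u \<omega>)) f"
  proof (rule E'.pc_ev_unique[OF f])
    fix g h :: "'F pc_poly" assume gh: "g \<in> pc_polys n \<Omega>" "h \<in> pc_polys n \<Omega>"
    show "c (pc_ev ?A x u (g + h)) = c (pc_ev ?A x u g) \<oplus>\<^bsub>?A\<^esub> c (pc_ev ?A x u h)"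
      using E.pc_ev_add[OF gh] closed gh
      by (simp add: module_mat_simps c_add)
    show "c (pc_ev ?A x u (g * h)) = c (pc_ev ?A x u g) \<otimes>\<^bsub>?A\<^esub> c (pc_ev ?A x u h)"
      using E.pc_ev_mult[OF gh] closed gh by (simp add: module_mat_simps c_mult)
  next
    fix a :: 'F
    show "c (pc_ev ?A x u (pc_const a)) = a \<odot>\<^bsub>?A\<^esub> \<one>\<^bsub>?A\<^esub>"
      using PQ by (simp add: E.pc_ev_const module_mat_simps c_def mult_smult_distrib[of P s s "1\<^sub>m s" s a]
          mult_smult_assoc_mat[of P s s Q s a])
  qed (simp_all add: E.pc_ev_X E.pc_ev_U)
  moreover have "B = c (pc_ev ?A x u f)" by (simp add: c_def B Zxu)
  ultimately show ?thesis
    unfolding pc_image_def using E'.x_closed E'.u_closed E'.u_comm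
    by (intro CollectI exI[of _ "\<lambda>i. c (x i)"] exI[of _ "\<lambda>\<omega>. c (u \<omega>)"] conjI ballI) simp_all
qed

section \<open>Evaluation with diagonal \<open>u\<^sub>\<omega>\<close>\<close>

text \<open>For indices below \<open>s\<close>, the entry of a product of \<open>s\<close> by
  \<open>s\<close> matrices given as functions, expanded over paths of indices.\<close>

primrec path_sum :: "nat \<Rightarrow> (nat \<Rightarrow> nat \<Rightarrow> 'a::comm_semiring_1) list \<Rightarrow> nat \<Rightarrow> nat \<Rightarrow> 'a" where
  "path_sum s [] i k = (if i = k then 1 else 0)"
| "path_sum s (A # As) i k = (\<Sum>j<s. A i j * path_sum s As j k)"

text \<open>Commutation with the diagonal matrix of \<open>\<upsilon> \<omega>\<close> multiplies
  the \<open>(i, k)\<close> entry by \<open>\<upsilon> \<omega> i - \<upsilon> \<omega> k\<close>;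
  this is the accumulated factor of a nested commutator.\<close>

definition comm_weight :: "(nat \<Rightarrow> nat \<Rightarrow> 'a::comm_ring_1) \<Rightarrow> nat list \<Rightarrow> nat \<Rightarrow> nat \<Rightarrow> 'a" where
  "comm_weight \<upsilon> ws i k = (\<Prod>\<omega>\<leftarrow>ws. \<upsilon> \<omega> i - \<upsilon> \<omega> k)"

lemma nested_commutator_Cons:
  "as \<noteq> [] \<Longrightarrow> nested_commutator (a # as) = commutator a (nested_commutator as)"
  by (cases as) auto

lemma seq_partitions_set:
  "a \<in> seq_partitions n \<Omega> \<Longrightarrow> j \<in> {1..n} \<Longrightarrow> set (a j) \<subseteq> \<Omega>"
  by (auto simp: seq_partitions_def PiE_iff)

context
  fixes s n :: nat and \<Omega> :: "nat set" and \<upsilon> :: "nat \<Rightarrow> nat \<Rightarrow> 'F::field" and \<xi> :: "nat \<Rightarrow> nat \<Rightarrow> nat \<Rightarrow> 'F"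
begin

abbreviation "x_mat j \<equiv> mat s s (\<lambda>(i, k). \<xi> j i k)"
abbreviation "u_diag \<omega> \<equiv> mat s s (\<lambda>(i, k). if i = k then \<upsilon> \<omega> i else 0)"
abbreviation "diag_ev \<equiv> pc_ev (mat_algebra TYPE('F) s) x_mat u_diag"

lemma u_diag_mult_left: "M \<in> carrier_mat s s \<Longrightarrow> u_diag \<omega> * M = mat s s (\<lambda>(i, k). \<upsilon> \<omega> i * M $$ (i, k))"
  by (rule eq_matI)
    (auto simp: scalar_prod_def if_distrib[of "\<lambda>x. x * _"] cong: if_cong)

lemma u_diag_mult_right: "M \<in> carrier_mat s s \<Longrightarrow> M * u_diag \<omega> = mat s s (\<lambda>(i, k). M $$ (i, k) * \<upsilon> \<omega> k)"
  by (rule eq_matI)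
    (auto simp: scalar_prod_def if_distrib[of "\<lambda>x. _ * x"] cong: if_cong)

interpretation U: unital_algebra "mat_algebra TYPE('F) s"
  by (rule unital_algebra_mat)

interpretation E: pc_evaluation "mat_algebra TYPE('F) s" n \<Omega> x_mat u_diag
  by unfold_locales (auto simp: module_mat_simps u_diag_mult_left mult.commute intro!: eq_matI)

lemma diag_ev_carrier: "g \<in> pc_polys n \<Omega> \<Longrightarrow> diag_ev g \<in> carrier_mat s s"
  using E.pc_ev_closed by (simp add: module_mat_simps)

lemma diag_ev_image: "diag_ev g \<in> pc_image (mat_algebra TYPE('F) s) n \<Omega> g"
  unfolding pc_image_def using E.x_closed E.u_closed E.u_comm by blast

lemma uminus_pc_polys: "g \<in> pc_polys n \<Omega> \<Longrightarrow> - g \<in> (pc_polys n \<Omega> :: 'F pc_poly set)"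
  by (simp add: pc_polys_def)

lemma diff_pc_polys:
  "g \<in> pc_polys n \<Omega> \<Longrightarrow> h \<in> pc_polys n \<Omega> \<Longrightarrow> g - h \<in> (pc_polys n \<Omega> :: 'F pc_poly set)"
  using E.pc_polys_add[of g "- h"] uminus_pc_polys[of h] by simp

lemma diag_ev_diff:
  assumes "g \<in> pc_polys n \<Omega>" "h \<in> pc_polys n \<Omega>"
  shows "diag_ev (g - h) = diag_ev g - diag_ev h"
proof -
  have "diag_ev g = diag_ev (g - h) + diag_ev h"
    using E.pc_ev_add[of "g - h" h] assms diff_pc_polys by (simp add: module_mat_simps)
  thus ?thesis
    using diag_ev_carrier[OF diff_pc_polys[OF assms]] diag_ev_carrier[OF assms(2)]
    by (intro eq_matI) auto
qed

lemma diag_ev_nested_commutator: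
  assumes "set ws \<subseteq> \<Omega>" "j \<in> {1..n}"
  defines "g \<equiv> nested_commutator (map pc_U ws @ [pc_X j])"
  shows "g \<in> pc_polys n \<Omega>" and "diag_ev g = mat s s (\<lambda>(i, k). comm_weight \<upsilon> ws i k * \<xi> j i k)"
proof -
  have "g \<in> pc_polys n \<Omega> \<and> diag_ev g = mat s s (\<lambda>(i, k). comm_weight \<upsilon> ws i k * \<xi> j i k)"
    unfolding g_def using assms(1)
  proof (induction ws)
    case Nil
    have "pc_X j \<in> (pc_polys n \<Omega> :: 'F pc_poly set)"
      using assms(2) by (auto simp: pc_X_def pc_polys_def)
    then show ?case using E.pc_ev_X[OF assms(2)] by (simp add: comm_weight_def)
  next
    case (Cons \<omega> ws)
    define h :: "'F pc_poly" where "h = nested_commutator (map pc_U ws @ [pc_X j])"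
    have h: "h \<in> pc_polys n \<Omega>" "diag_ev h = mat s s (\<lambda>(i, k). comm_weight \<upsilon> ws i k * \<xi> j i k)"
      using Cons by (auto simp: h_def)
    have U: "pc_U \<omega> \<in> (pc_polys n \<Omega> :: 'F pc_poly set)" "diag_ev (pc_U \<omega>) = u_diag \<omega>"
      using Cons.prems E.pc_ev_U[of \<omega>] by (auto simp: pc_U_def pc_polys_def)
    have "nested_commutator (map pc_U (\<omega> # ws) @ [pc_X j]) = pc_U \<omega> * h - h * pc_U \<omega>"
      by (simp add: nested_commutator_Cons h_def commutator_def)
    moreover have "diag_ev (pc_U \<omega> * h - h * pc_U \<omega>) = u_diag \<omega> * diag_ev h - diag_ev h * u_diag \<omega>"
      using E.pc_ev_mult U h(1) by (simp add: diag_ev_diff E.pc_polys_mult module_mat_simps)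
    moreover have "\<dots> = mat s s (\<lambda>(i, k). comm_weight \<upsilon> (\<omega> # ws) i k * \<xi> j i k)"
      using diag_ev_carrier[OF h(1)]
      by (simp add: u_diag_mult_left u_diag_mult_right)
        (auto simp: h(2) comm_weight_def algebra_simps intro!: eq_matI)
    ultimately show ?case
      using U h(1) by (simp add: diff_pc_polys E.pc_polys_mult)
  qed
  thus "g \<in> pc_polys n \<Omega>" "diag_ev g = mat s s (\<lambda>(i, k). comm_weight \<upsilon> ws i k * \<xi> j i k)" by auto
qed

lemma diag_ev_pc_X_prod:
  assumes a: "\<And>j. j \<in> {1..n} \<Longrightarrow> set (a j) \<subseteq> \<Omega>" and "set js \<subseteq> {1..n}"
  defines "g \<equiv> prod_list (map (pc_X_sup a) js)"
  shows "g \<in> pc_polys n \<Omega>"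
    and "diag_ev g = mat s s (\<lambda>(i, k). path_sum s (map (\<lambda>j i k. comm_weight \<upsilon> (a j) i k * \<xi> j i k) js) i k)"
proof -
  have "g \<in> pc_polys n \<Omega> \<and>
    diag_ev g = mat s s (\<lambda>(i, k). path_sum s (map (\<lambda>j i k. comm_weight \<upsilon> (a j) i k * \<xi> j i k) js) i k)"
    unfolding g_def using assms(2)
  proof (induction js)
    case Nil
    have "(1 :: 'F pc_poly) = pc_const 1" by (simp add: pc_const_def)
    then have "(1 :: 'F pc_poly) \<in> pc_polys n \<Omega>"
      by (simp add: pc_const_def pc_polys_def zero_pc_mon_def)
    then show ?case
      using E.pc_ev_one by (auto simp: module_mat_simps intro!: eq_matI)
  next
    case (Cons j js)
    have X: "pc_X_sup a j \<in> (pc_polys n \<Omega> :: 'F pc_poly set)"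
      "diag_ev (pc_X_sup a j) = mat s s (\<lambda>(i, k). comm_weight \<upsilon> (a j) i k * \<xi> j i k)"
      using diag_ev_nested_commutator[of "a j" j] a Cons.prems by (auto simp: pc_X_sup_def)
    with Cons show ?case
      using E.pc_ev_mult[of "pc_X_sup a j" "prod_list (map (pc_X_sup a) js)"]
      by (auto simp: module_mat_simps E.pc_polys_mult scalar_prod_def atLeast0LessThan intro!: eq_matI)
  qed
  thus "g \<in> pc_polys n \<Omega>"
    "diag_ev g = mat s s (\<lambda>(i, k). path_sum s (map (\<lambda>j i k. comm_weight \<upsilon> (a j) i k * \<xi> j i k) js) i k)"
    by auto
qed

lemma diag_ev_sum:
  assumes "finite T" "\<And>t. t \<in> T \<Longrightarrow> F t \<in> pc_polys n \<Omega> \<and> diag_ev (F t) = mat s s (G t)"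
  shows "sum F T \<in> pc_polys n \<Omega> \<and> diag_ev (sum F T) = mat s s (\<lambda>ik. \<Sum>t\<in>T. G t ik)"
  using assms
proof (induction T)
  case empty
  have "(0 :: 'F pc_poly) \<in> pc_polys n \<Omega>" by (simp add: pc_polys_def)
  then show ?case by (auto simp: module_mat_simps)
next
  case (insert t T)
  then show ?case
    using E.pc_ev_add[of "F t" "sum F T"]
    by (auto simp: module_mat_simps E.pc_polys_add intro!: eq_matI)
qed

text \<open>With diagonal \<open>u_diag\<close> the commutators only rescale entries, so each
  monomial evaluates to a weighted sum over paths. The block argument below works with these
  scalars.\<close>

lemma diag_ev_admissible:
  assumes "finite \<Omega>"
  defines "P \<equiv> {\<sigma>. \<sigma> permutes {1..n}}"
  shows "diag_ev (\<Sum>\<sigma>\<in>P. \<Sum>a\<in>seq_partitions n \<Omega>.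
      pc_const (l \<sigma> a) * prod_list (map (\<lambda>i. pc_X_sup a (\<sigma> i)) [1..<n+1]))
    = mat s s (\<lambda>(i, k). \<Sum>\<sigma>\<in>P. \<Sum>a\<in>seq_partitions n \<Omega>.
      l \<sigma> a * path_sum s (map (\<lambda>j i k. comm_weight \<upsilon> (a j) i k * \<xi> j i k) (map \<sigma> [1..<n+1])) i k)"
proof -
  let ?g = "\<lambda>\<sigma> a. pc_const (l \<sigma> a) * prod_list (map (\<lambda>i. pc_X_sup a (\<sigma> i)) [1..<n+1])"
  let ?h = "\<lambda>\<sigma> a (i, k). l \<sigma> a * path_sum s (map (\<lambda>j i k. comm_weight \<upsilon> (a j) i k * \<xi> j i k) (map \<sigma> [1..<n+1])) i k"
  have summand: "?g \<sigma> a \<in> pc_polys n \<Omega> \<and> diag_ev (?g \<sigma> a) = mat s s (?h \<sigma> a)"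
    if "\<sigma> \<in> P" "a \<in> seq_partitions n \<Omega>" for \<sigma> a
  proof -
    have "\<sigma> ` {1..n} = {1..n}" using that by (simp add: P_def permutes_image)
    moreover have "{1..<n+1} = {1..n}" by auto
    ultimately have "set (map \<sigma> [1..<n+1]) \<subseteq> {1..n}" by (simp only: set_map set_upt order.refl)
    define js where "js = map \<sigma> [1..<n+1]"
    have "set js \<subseteq> {1..n}" unfolding js_def by fact
    define g :: "'F pc_poly" where "g = prod_list (map (pc_X_sup a) js)"
    have g: "g \<in> pc_polys n \<Omega>"
      "diag_ev g = mat s s (\<lambda>(i, k). path_sum s (map (\<lambda>j i k. comm_weight \<upsilon> (a j) i k * \<xi> j i k) js) i k)"
      using diag_ev_pc_X_prod[of a js] seq_partitions_set[OF that(2)] \<open>set js \<subseteq> {1..n}\<close>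
      by (auto simp: g_def)
    have const: "pc_const (l \<sigma> a) \<in> (pc_polys n \<Omega> :: 'F pc_poly set)"
      by (simp add: pc_const_def pc_polys_def zero_pc_mon_def)
    have "diag_ev (pc_const (l \<sigma> a) * g) = l \<sigma> a \<cdot>\<^sub>m diag_ev g"
      using E.pc_ev_mult[OF const g(1)] diag_ev_carrier[OF g(1)]
      by (simp add: E.pc_ev_const module_mat_simps mult_smult_assoc_mat[of "1\<^sub>m s" s s "diag_ev g" s])
    also have "\<dots> = mat s s (\<lambda>(i, k). l \<sigma> a * path_sum s (map (\<lambda>j i k. comm_weight \<upsilon> (a j) i k * \<xi> j i k) js) i k)"
      by (auto simp: g(2) intro!: eq_matI)
    finally show ?thesis
      using E.pc_polys_mult[OF const g(1)] by (simp only: g_def js_def list.map_comp comp_def)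
  qed
  have fin: "finite P" by (simp add: P_def finite_permutations)
  have "(\<Sum>a\<in>seq_partitions n \<Omega>. ?g \<sigma> a) \<in> pc_polys n \<Omega> \<and>
      diag_ev (\<Sum>a\<in>seq_partitions n \<Omega>. ?g \<sigma> a) = mat s s (\<lambda>ik. \<Sum>a\<in>seq_partitions n \<Omega>. ?h \<sigma> a ik)"
    if "\<sigma> \<in> P" for \<sigma>
    using diag_ev_sum[OF finite_seq_partitions[OF assms(1)] summand[OF that]] .
  from diag_ev_sum[OF fin this] show ?thesis
    by (simp add: case_prod_unfold)
qed

end

section \<open>Block diagonal cyclic shifts\<close>

lemma path_sum_append:
  "i < s \<Longrightarrow> path_sum s (As @ Bs) i k = (\<Sum>j<s. path_sum s As i j * path_sum s Bs j k)"
proof (induction As arbitrary: i)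
  case Nil
  then show ?case by (simp add: if_distrib[of "\<lambda>x. x * _"] cong: if_cong)
next
  case (Cons A As)
  have "path_sum s ((A # As) @ Bs) i k = (\<Sum>m<s. \<Sum>j<s. A i m * (path_sum s As m j * path_sum s Bs j k))"
    using Cons.IH by (simp add: sum_distrib_left)
  also have "\<dots> = (\<Sum>j<s. \<Sum>m<s. A i m * (path_sum s As m j * path_sum s Bs j k))"
    by (rule sum.swap)
  finally show ?case by (simp add: sum_distrib_right mult.assoc)
qed

lemma line_poly_path_sum:
  assumes "\<And>j i k. line_poly (\<lambda>z. A z j i k)"
  shows "line_poly (\<lambda>z. path_sum s (map (A z) js) i k)"
  by (induction js arbitrary: i) (auto intro!: line_poly_intros assms)

lemma line_poly_comm_weight:
  "line_poly (\<lambda>z. comm_weight (\<lambda>v i. z (v, i)) ws i k)"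
  by (induction ws) (auto simp: comm_weight_def intro!: line_poly_intros)

lemma seq_partitions_ex1:
  assumes "a \<in> seq_partitions n \<Omega>" "\<omega> \<in> \<Omega>"
  shows "\<exists>!i. i \<in> {1..n} \<and> \<omega> \<in> set (a i)"
proof -
  let ?P = "\<lambda>p. case p of (i, j) \<Rightarrow> i \<in> {1..n} \<and> j < length (a i) \<and> a i ! j = \<omega>"
  have "\<exists>!p. ?P p" using assms unfolding seq_partitions_def by blast
  then obtain p where p: "?P p" and uniq: "\<forall>q. ?P q \<longrightarrow> q = p" by (rule ex1E)
  show ?thesis
  proof (rule ex1I[of _ "fst p"])
    show "fst p \<in> {1..n} \<and> \<omega> \<in> set (a (fst p))" using p by (auto split: prod.splits)
    fix i assume "i \<in> {1..n} \<and> \<omega> \<in> set (a i)"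
    then obtain j where "?P (i, j)" by (auto simp: in_set_conv_nth)
    with uniq have "(i, j) = p" by blast
    thus "i = fst p" by auto
  qed
qed

text \<open>Each element of \<open>\<Omega>\<close> occupies exactly one component of
  \<open>a\<close> and one of \<open>a'\<close>, so no inclusion can be proper; strictly increasing
  lists are determined by their sets.\<close>

lemma seq_partitions_eqI:
  assumes a: "a \<in> seq_partitions n \<Omega>" and a': "a' \<in> seq_partitions n \<Omega>"
    and sub: "\<And>i. i \<in> {1..n} \<Longrightarrow> set (a i) \<subseteq> set (a' i)"
  shows "a = a'"
proof (rule PiE_ext)
  let ?S = "\<lambda>_. {xs. sorted_wrt (<) xs \<and> set xs \<subseteq> \<Omega>}"
  show aP: "a \<in> {1..n} \<rightarrow>\<^sub>E ?S undefined" and a'P: "a' \<in> {1..n} \<rightarrow>\<^sub>E ?S undefined"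
    using a a' by (auto simp: seq_partitions_def)
  fix i assume i: "i \<in> {1..n}"
  have "\<omega> \<in> set (a i)" if "\<omega> \<in> set (a' i)" for \<omega>
  proof -
    have "\<omega> \<in> \<Omega>" using seq_partitions_set[OF a' i] that by auto
    then obtain i' where "i' \<in> {1..n}" "\<omega> \<in> set (a i')"
      using seq_partitions_ex1[OF a] by blast
    with sub seq_partitions_ex1[OF a' \<open>\<omega> \<in> \<Omega>\<close>] i that show ?thesis by blast
  qed
  with sub[OF i] have "set (a i) = set (a' i)" by blast
  moreover have "sorted_wrt (<) (a i)" "sorted_wrt (<) (a' i)"
    using PiE_mem[OF aP i] PiE_mem[OF a'P i] by auto
  ultimately show "a i = a' i" using strict_sorted_equal by blast
qed

text \<open>Blocks are residue classes: an index \<open>i\<close> below \<open>b * n\<close> belongs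
  to block \<open>i mod b\<close>, which has \<open>n\<close> elements. With this interleaving the
  indices below \<open>b\<close> lie in distinct blocks, so the upper-left corner of size
  \<open>b\<close> contains one entry of each matrix block.\<close>

locale block_shift =
  fixes b n :: nat
  assumes b_pos: "b > 0" and n_pos: "n > 0"
begin

abbreviation "s \<equiv> b * n"

definition sh :: "nat \<Rightarrow> nat \<Rightarrow> nat" where
  "sh r i = (i + b * r) mod s"

lemma sh_less [simp]: "sh r i < s"
  using b_pos n_pos by (simp add: sh_def)

lemma sh_mod [simp]: "sh r i mod b = i mod b"
  by (simp add: sh_def mod_mult_right_eq mod_mod_cancel)

lemma sh_0: "i < s \<Longrightarrow> sh 0 i = i"
  by (simp add: sh_def)

lemma sh_n: "i < s \<Longrightarrow> sh n i = i"
  by (simp add: sh_def)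

lemma sh_sh: "sh q (sh r i) = sh (q + r) i"
  by (simp add: sh_def mod_add_left_eq) (simp add: algebra_simps)

lemma sh_inj:
  assumes "sh q i = sh r i" "q < n" "r < n"
  shows "q = r"
proof -
  have "[i + b * q = i + b * r] (mod s)" using assms(1) by (simp add: sh_def cong_def)
  hence "[b * q = b * r] (mod s)" by (simp add: cong_add_lcancel_nat)
  hence "[q = r] (mod n)" using b_pos by (simp add: cong_def mod_mult_mult1)
  thus ?thesis using assms(2,3) by (simp add: cong_def)
qed

text \<open>An entry of the nested commutator for variable \<open>j\<close>, when its matrix is the
  cyclic shift along \<open>sh 1\<close> with weights \<open>z (j, i)\<close> and the diagonal
  matrices have entries \<open>z (\<omega>, i)\<close>.\<close>

definition step :: "(nat \<times> nat \<Rightarrow> 'F::field) \<Rightarrow> (nat \<Rightarrow> nat list) \<Rightarrow> nat \<Rightarrow> nat \<Rightarrow> nat \<Rightarrow> 'F" where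
  "step z a j i k = comm_weight (\<lambda>v i. z (v, i)) (a j) i k * (if k = sh 1 i then z (j, i) else 0)"

definition chain :: "(nat \<times> nat \<Rightarrow> 'F::field) \<Rightarrow> (nat \<Rightarrow> nat list) \<Rightarrow> nat list \<Rightarrow> nat \<Rightarrow> nat \<Rightarrow> 'F" where
  "chain z a js i k = path_sum s (map (step z a) js) i k"

lemma line_poly_chain: "line_poly (\<lambda>z. chain z a js i k)"
proof -
  have "line_poly (\<lambda>z. step z a j i k)" for j i k
    unfolding step_def by (cases "k = sh 1 i") (auto intro!: line_poly_intros line_poly_comm_weight)
  thus ?thesis unfolding chain_def by (rule line_poly_path_sum)
qed

text \<open>Each weighted shift leaves only one way to continue, so the single path from
  \<open>i\<close> runs through the points \<open>sh r i\<close>.\<close>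

lemma chain_eq:
  "i < s \<Longrightarrow> chain z a js i k = (if k = sh (length js) i
     then \<Prod>r<length js. z (js ! r, sh r i) * comm_weight (\<lambda>v i. z (v, i)) (a (js ! r)) (sh r i) (sh (Suc r) i)
     else 0)"
proof (induction js arbitrary: i)
  case Nil
  then show ?case by (auto simp: chain_def sh_0)
next
  case (Cons j js)
  have "chain z a (j # js) i k = (\<Sum>m<s. if m = sh 1 i then comm_weight (\<lambda>v i. z (v, i)) (a j) i m * z (j, i) * chain z a js m k else 0)"
    unfolding chain_def list.map path_sum.simps by (intro sum.cong refl) (simp add: step_def)
  also have "\<dots> = comm_weight (\<lambda>v i. z (v, i)) (a j) i (sh 1 i) * z (j, i) * chain z a js (sh 1 i) k"
    by (subst sum.delta) auto
  finally show ?case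
    using Cons.IH[of "sh 1 i"] Cons.prems
    by (simp add: sh_sh prod.lessThan_Suc_shift sh_0 del: prod.lessThan_Suc)
qed

text \<open>Splitting at the only occurrence of \<open>c\<close> exhibits linearity in
  \<open>Y\<close>: the chains on both sides of it do not involve \<open>Y\<close>.\<close>

lemma path_sum_split:
  fixes z :: "nat \<times> nat \<Rightarrow> 'F::field" and Y :: "nat \<Rightarrow> nat \<Rightarrow> 'F"
  assumes "c \<notin> set js" "c \<notin> set js'" "i < s"
  defines "X \<equiv> \<lambda>j i k. if j = c then Y i k else if k = sh 1 i then z (j, i) else 0"
  shows "path_sum s (map (\<lambda>j i k. comm_weight (\<lambda>v i. z (v, i)) (a j) i k * X j i k) (js @ c # js')) i k
    = (\<Sum>j<s. \<Sum>m<s. chain z a js i j * comm_weight (\<lambda>v i. z (v, i)) (a c) j m * chain z a js' m k * Y j m)"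
proof -
  let ?W = "\<lambda>j i k. comm_weight (\<lambda>v i. z (v, i)) (a j) i k * X j i k"
  have W: "map ?W js'' = map (step z a) js''" if "c \<notin> set js''" for js''
    using that by (auto simp: X_def step_def fun_eq_iff)
  have "path_sum s (map ?W (js @ c # js')) i k
      = (\<Sum>j<s. chain z a js i j * (\<Sum>m<s. comm_weight (\<lambda>v i. z (v, i)) (a c) j m * Y j m * chain z a js' m k))"
    unfolding map_append list.map(2) path_sum_append[OF \<open>i < s\<close>] W[OF assms(1)] W[OF assms(2)]
    by (simp add: chain_def X_def)
  thus ?thesis by (simp add: sum_distrib_left mult_ac)
qed

end

section \<open>The value of \<open>f\<close> as a linear operator on the remaining variable\<close>

text \<open>As \<open>\<Omega>\<close> and \<open>{1..n}\<close> are disjoint, one function \<open>z\<close> serves both the diagonal entries \<open>z (\<omega>, i)\<close> of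
  the \<open>u\<^sub>\<omega>\<close> and the weights \<open>z (j, i)\<close> of the \<open>x\<^sub>j\<close>.\<close>

locale block_operator = block_shift +
  fixes \<Omega> :: "nat set" and l :: "(nat \<Rightarrow> nat) \<Rightarrow> (nat \<Rightarrow> nat list) \<Rightarrow> 'F::field"
    and \<sigma>\<^sub>0 :: "nat \<Rightarrow> nat" and a\<^sub>0 :: "nat \<Rightarrow> nat list"
  assumes inf: "infinite (UNIV :: 'F set)"
    and fin_\<Omega>: "finite \<Omega>" and disj_\<Omega>: "\<Omega> \<inter> {1..n} = {}"
    and \<sigma>\<^sub>0: "\<sigma>\<^sub>0 permutes {1..n}" and a\<^sub>0: "a\<^sub>0 \<in> seq_partitions n \<Omega>" and l\<^sub>0: "l \<sigma>\<^sub>0 a\<^sub>0 \<noteq> 0"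
begin

abbreviation "c \<equiv> \<sigma>\<^sub>0 1"
abbreviation "c_pos \<sigma> \<equiv> inv_into UNIV \<sigma> c"
abbreviation "perms \<equiv> {\<sigma>. \<sigma> permutes {1..n}}"

text \<open>Contribution of one monomial: the shifts left of X_c lead from \<open>i\<close> to row
  \<open>j\<close> of \<open>Y\<close>, those right of it from column \<open>m\<close> to
  \<open>k\<close>.\<close>

definition term_coeff ::
  "(nat \<times> nat \<Rightarrow> 'F) \<Rightarrow> (nat \<Rightarrow> nat) \<Rightarrow> (nat \<Rightarrow> nat list) \<Rightarrow> nat \<Rightarrow> nat \<Rightarrow> nat \<Rightarrow> nat \<Rightarrow> 'F"
where
  "term_coeff z \<sigma> a i k j m = chain z a (map \<sigma> [1..<c_pos \<sigma>]) i j
     * comm_weight (\<lambda>v i. z (v, i)) (a c) j m * chain z a (map \<sigma> [c_pos \<sigma> + 1..<n + 1]) m k"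

text \<open>The coefficient of the entry \<open>(j, m)\<close> of \<open>Y = x\<^sub>c\<close> in the entry \<open>(i, k)\<close> of the value of \<open>f\<close>.\<close>

definition op_coeff :: "(nat \<times> nat \<Rightarrow> 'F) \<Rightarrow> nat \<times> nat \<Rightarrow> nat \<times> nat \<Rightarrow> 'F" where
  "op_coeff z = (\<lambda>(i, k) (j, m).
     \<Sum>\<sigma>\<in>perms. \<Sum>a\<in>seq_partitions n \<Omega>. l \<sigma> a * term_coeff z \<sigma> a i k j m)"

lemma line_poly_op_coeff: "line_poly (\<lambda>z. op_coeff z ik jm)"
  by (cases ik; cases jm)
    (auto simp: op_coeff_def term_coeff_def intro!: line_poly_intros line_poly_chain line_poly_comm_weight)

lemma c_range: "c \<in> {1..n}"
  using permutes_in_image[OF \<sigma>\<^sub>0, of 1] n_pos by simp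

lemma inv_c_range: "\<sigma> permutes {1..n} \<Longrightarrow> c_pos \<sigma> \<in> {1..n}"
  using permutes_in_image[OF permutes_inv, of \<sigma> "{1..n}" c] c_range by simp

lemma \<sigma>_inv_c: "\<sigma> permutes {1..n} \<Longrightarrow> \<sigma> (c_pos \<sigma>) = c"
  by (simp add: permutes_inverses)

text \<open>Shifts stay within a residue class, so the blocks of \<open>Y\<close> can be treated
  independently.\<close>

lemma op_coeff_eq_0:
  assumes "i < s" "m < s" "j mod b \<noteq> i mod b \<or> m mod b \<noteq> k mod b"
  shows "op_coeff z (i, k) (j, m) = 0"
proof -
  have "term_coeff z \<sigma> a i k j m = 0" for \<sigma> a
    using assms by (auto simp: term_coeff_def chain_eq)
  thus ?thesis unfolding op_coeff_def by (simp only: split_conv) simp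
qed

text \<open>Every monomial contains X_c exactly once, at place \<open>c_pos \<sigma>\<close>, and is
  split there; the rest is exchange of finite sums.\<close>

lemma sum_path_sum_eq_op_coeff:
  assumes "i < s"
  defines "X \<equiv> \<lambda>z Y j i k. if j = c then Y i k else if k = sh 1 i then z (j, i) else 0"
  shows "(\<Sum>\<sigma>\<in>perms. \<Sum>a\<in>seq_partitions n \<Omega>. l \<sigma> a *
      path_sum s (map (\<lambda>j i k. comm_weight (\<lambda>v i. z (v, i)) (a j) i k * X z Y j i k)
        (map \<sigma> [1..<n + 1])) i k)
    = (\<Sum>j<s. \<Sum>m<s. op_coeff z (i, k) (j, m) * Y j m)"
proof -
  have "(\<Sum>j<s. \<Sum>m<s. op_coeff z (i, k) (j, m) * Y j m)
    = (\<Sum>j<s. \<Sum>\<sigma>\<in>perms. \<Sum>m<s. \<Sum>a\<in>seq_partitions n \<Omega>. l \<sigma> a * term_coeff z \<sigma> a i k j m * Y j m)"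
    unfolding op_coeff_def split_conv sum_distrib_right by (rule sum.cong[OF refl sum.swap])
  also have "\<dots> = (\<Sum>\<sigma>\<in>perms. \<Sum>j<s. \<Sum>a\<in>seq_partitions n \<Omega>. \<Sum>m<s. l \<sigma> a * term_coeff z \<sigma> a i k j m * Y j m)"
    by (subst sum.swap) (rule sum.cong[OF refl sum.cong[OF refl sum.swap]])
  also have "\<dots> = (\<Sum>\<sigma>\<in>perms. \<Sum>a\<in>seq_partitions n \<Omega>. \<Sum>j<s. \<Sum>m<s. l \<sigma> a * term_coeff z \<sigma> a i k j m * Y j m)"
    by (rule sum.cong[OF refl sum.swap])
  also have "\<dots> = (\<Sum>\<sigma>\<in>perms. \<Sum>a\<in>seq_partitions n \<Omega>. l \<sigma> a *
      path_sum s (map (\<lambda>j i k. comm_weight (\<lambda>v i. z (v, i)) (a j) i k * X z Y j i k)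
        (map \<sigma> [1..<n + 1])) i k)"
  proof (intro sum.cong refl)
    fix \<sigma> a assume "\<sigma> \<in> perms"
    hence \<sigma>: "\<sigma> permutes {1..n}" by simp
    define r where "r = c_pos \<sigma>"
    have r: "r \<in> {1..n}" "\<sigma> r = c" using inv_c_range[OF \<sigma>] \<sigma>_inv_c[OF \<sigma>] by (auto simp: r_def)
    have "[1..<n + 1] = [1..<r] @ r # [r + 1..<n + 1]"
      using r(1) upt_add_eq_append[of 1 r "n + 1 - r"] upt_conv_Cons[of r "n + 1"] by simp
    hence js: "map \<sigma> [1..<n + 1] = map \<sigma> [1..<r] @ c # map \<sigma> [r + 1..<n + 1]"
      using r(2) by (simp del: upt_Suc)
    have "c \<notin> set (map \<sigma> [1..<r])" "c \<notin> set (map \<sigma> [r + 1..<n + 1])"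
      unfolding r(2)[symmetric] by (auto simp: inj_eq[OF permutes_inj[OF \<sigma>]])
    from path_sum_split[OF this \<open>i < s\<close>, where z = z and a = a and Y = Y and k = k]
    show "(\<Sum>j<s. \<Sum>m<s. l \<sigma> a * term_coeff z \<sigma> a i k j m * Y j m) = l \<sigma> a *
      path_sum s (map (\<lambda>j i k. comm_weight (\<lambda>v i. z (v, i)) (a j) i k * X z Y j i k)
        (map \<sigma> [1..<n + 1])) i k"
      unfolding X_def js by (simp only: r_def term_coeff_def sum_distrib_left mult.assoc)
  qed
  finally show ?thesis by simp
qed

text \<open>The factor by which the operator acts when the parameters of the block row of \<open>Y\<close> vanish.\<close>

definition \<gamma> :: "(nat \<times> nat \<Rightarrow> 'F) \<Rightarrow> nat \<Rightarrow> 'F" where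
  "\<gamma> z m = (\<Sum>\<sigma> | \<sigma> permutes {1..n} \<and> \<sigma> 1 = c. \<Sum>a\<in>seq_partitions n \<Omega>. l \<sigma> a *
     ((\<Prod>\<omega>\<leftarrow>a c. - z (\<omega>, m)) * (\<Prod>r<n - 1. z (\<sigma> (r + 2), sh r m) *
        comm_weight (\<lambda>v i. z (v, i)) (a (\<sigma> (r + 2))) (sh r m) (sh (Suc r) m))))"

lemma line_poly_\<gamma>: "line_poly (\<lambda>z. \<gamma> z m)"
proof -
  have "line_poly (\<lambda>z. \<Prod>\<omega>\<leftarrow>ws. - z (\<omega>, m) :: 'F)" for ws :: "nat list"
  proof (induction ws)
    case (Cons \<omega> ws)
    then have "line_poly (\<lambda>z. (0 - z (\<omega>, m)) * (\<Prod>\<omega>\<leftarrow>ws. - z (\<omega>, m) :: 'F))"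
      by (intro line_poly_intros)
    then show ?case by simp
  qed simp
  thus ?thesis unfolding \<gamma>_def by (intro line_poly_intros line_poly_comm_weight)
qed

text \<open>The shift orbit of \<open>m\<close> stays in its residue class. This permits changing
  the parameters of another block.\<close>

lemma \<gamma>_cong:
  assumes "\<And>v i. i mod b = m mod b \<Longrightarrow> z (v, i) = z' (v, i)"
  shows "\<gamma> z m = \<gamma> z' m"
  using assms unfolding \<gamma>_def comm_weight_def by simp

text \<open>A shift to the left of X_c would contribute a vanishing weight from block
  \<open>p\<close>, and in the commutators around X_c only the column terms
  \<open>- z (\<omega>, m)\<close> are left. What remains is right multiplication by a diagonal
  matrix times a power of the shift.\<close>

lemma op_coeff_special:
  assumes z: "\<And>v i. i mod b = p \<Longrightarrow> z (v, i) = 0"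
    and ij: "i < s" "m < s" "i mod b = p" "j mod b = p"
  shows "op_coeff z (i, k) (j, m) = (if j = i \<and> k = sh (n - 1) m then \<gamma> z m else 0)"
proof -
  let ?t = "\<lambda>\<sigma> a. term_coeff z \<sigma> a i k j m"
  have 0: "?t \<sigma> a = 0" if "\<sigma> permutes {1..n}" "\<sigma> 1 \<noteq> c" for \<sigma> a
  proof -
    have "c_pos \<sigma> \<noteq> 1" using \<sigma>_inv_c[OF that(1)] that(2) by metis
    hence "map \<sigma> [1..<c_pos \<sigma>] \<noteq> []" using inv_c_range[OF that(1)] by auto
    moreover have "chain z a js i j = 0" if "js \<noteq> []" for js
      using that z[OF ij(3)] by (cases js) (simp_all add: chain_def step_def if_distrib[of "\<lambda>x. _ * x"] cong: if_cong)
    ultimately have "chain z a (map \<sigma> [1..<c_pos \<sigma>]) i j = 0" by blast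
    thus ?thesis by (simp add: term_coeff_def)
  qed
  have 1: "?t \<sigma> a = (if j = i \<and> k = sh (n - 1) m then (\<Prod>\<omega>\<leftarrow>a c. - z (\<omega>, m)) *
      (\<Prod>r<n - 1. z (\<sigma> (r + 2), sh r m) *
        comm_weight (\<lambda>v i. z (v, i)) (a (\<sigma> (r + 2))) (sh r m) (sh (Suc r) m)) else 0)"
    if "\<sigma> permutes {1..n}" "\<sigma> 1 = c" for \<sigma> a
  proof -
    have "c_pos \<sigma> = 1" using permutes_inverses(2)[OF that(1), of 1] that(2) by simp
    moreover have "comm_weight (\<lambda>v i. z (v, i)) (a c) i m = (\<Prod>\<omega>\<leftarrow>a c. - z (\<omega>, m))"
      using ij(3) z by (simp add: comm_weight_def)
    \<comment> \<open>Place 1 is taken by X_c and lists count from 0, so index \<open>r\<close> to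
      its right is place \<open>r + 2\<close>.\<close>
    moreover have "map \<sigma> [2..<n + 1] ! r = \<sigma> (r + 2)" if "r < n - 1" for r
      using that by (simp del: upt_Suc add: add.commute)
    ultimately show ?thesis
      using ij(1,2) by (simp add: term_coeff_def chain_eq sh_0 numeral_2_eq_2 del: upt_Suc)
  qed
  have "op_coeff z (i, k) (j, m) = (\<Sum>\<sigma> | \<sigma> permutes {1..n} \<and> \<sigma> 1 = c. \<Sum>a\<in>seq_partitions n \<Omega>. l \<sigma> a * ?t \<sigma> a)"
    unfolding op_coeff_def split_conv
    by (rule sum.mono_neutral_right) (auto simp: finite_permutations 0)
  also have "\<dots> = (\<Sum>\<sigma> | \<sigma> permutes {1..n} \<and> \<sigma> 1 = c. \<Sum>a\<in>seq_partitions n \<Omega>. l \<sigma> a *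
      (if j = i \<and> k = sh (n - 1) m then (\<Prod>\<omega>\<leftarrow>a c. - z (\<omega>, m)) *
      (\<Prod>r<n - 1. z (\<sigma> (r + 2), sh r m) *
        comm_weight (\<lambda>v i. z (v, i)) (a (\<sigma> (r + 2))) (sh r m) (sh (Suc r) m)) else 0))"
    by (intro sum.cong refl) (simp only: mem_Collect_eq 1)
  also have "\<dots> = (if j = i \<and> k = sh (n - 1) m then \<gamma> z m else 0)"
    by (auto simp: \<gamma>_def)
  finally show ?thesis .
qed

text \<open>The witness isolates one term of the sum, giving the value
  \<open>l \<sigma>\<^sub>0 a\<^sub>0\<close>.\<close>

lemma \<gamma>_nonzero:
  assumes "m < s"
  shows "\<exists>z. \<gamma> z m \<noteq> 0"
proof -
  \<comment> \<open>The points \<open>sh r m\<close> with \<open>r < n\<close> are distinct;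
    \<open>pos\<close> recovers the number of shifts.\<close>
  define pos where "pos i = (THE r. r < n \<and> sh r m = i)" for i
  have pos: "pos (sh r m) = r" if "r < n" for r
    unfolding pos_def by (rule the_equality) (use that sh_inj in blast)+
  \<comment> \<open>The place in the monomial of \<open>\<sigma>\<^sub>0\<close> and
    \<open>a\<^sub>0\<close> at which U_\<omega> enters a commutator.\<close>
  define part where "part \<omega> = (THE k. k \<in> {1..n} \<and> \<omega> \<in> set (a\<^sub>0 (\<sigma>\<^sub>0 k)))" for \<omega>
  have part: "part \<omega> \<in> {1..n} \<and> \<omega> \<in> set (a\<^sub>0 (\<sigma>\<^sub>0 (part \<omega>)))"
    and part_eq: "k \<in> {1..n} \<Longrightarrow> \<omega> \<in> set (a\<^sub>0 (\<sigma>\<^sub>0 k)) \<Longrightarrow> part \<omega> = k" if "\<omega> \<in> \<Omega>" for \<omega> k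
  proof -
    from seq_partitions_ex1[OF a\<^sub>0 that] obtain i where i: "i \<in> {1..n}" "\<omega> \<in> set (a\<^sub>0 i)"
      and uniq: "\<And>i'. i' \<in> {1..n} \<Longrightarrow> \<omega> \<in> set (a\<^sub>0 i') \<Longrightarrow> i' = i" by blast
    obtain k\<^sub>0 where k\<^sub>0: "k\<^sub>0 \<in> {1..n}" "i = \<sigma>\<^sub>0 k\<^sub>0"
      using i(1) permutes_image[OF \<sigma>\<^sub>0] by blast
    have k_eq: "k = k\<^sub>0" if "k \<in> {1..n}" "\<omega> \<in> set (a\<^sub>0 (\<sigma>\<^sub>0 k))" for k
    proof -
      have "\<sigma>\<^sub>0 k \<in> {1..n}" using that(1) by (simp only: permutes_in_image[OF \<sigma>\<^sub>0])
      hence "\<sigma>\<^sub>0 k = \<sigma>\<^sub>0 k\<^sub>0" using uniq that(2) k\<^sub>0 by blast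
      thus ?thesis using permutes_inj[OF \<sigma>\<^sub>0] by (simp only: inj_eq)
    qed
    have "part \<omega> = k\<^sub>0" unfolding part_def using i k\<^sub>0 k_eq by (intro the_equality) blast+
    thus "part \<omega> \<in> {1..n} \<and> \<omega> \<in> set (a\<^sub>0 (\<sigma>\<^sub>0 (part \<omega>)))"
      "k \<in> {1..n} \<Longrightarrow> \<omega> \<in> set (a\<^sub>0 (\<sigma>\<^sub>0 k)) \<Longrightarrow> part \<omega> = k"
      using i k\<^sub>0 k_eq by blast+
  qed
  \<comment> \<open>Each difference along the shift orbit of \<open>m\<close> singles out one place of the monomial, so that only
     the term of \<open>\<sigma>\<^sub>0\<close> and \<open>a\<^sub>0\<close> survives.\<close>
  define z :: "nat \<times> nat \<Rightarrow> 'F" where "z = (\<lambda>(v, i).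
    if v \<in> \<Omega> then if part v \<le> pos i + 1 then - 1 else 0
    else if v = \<sigma>\<^sub>0 (pos i + 2) then 1 else 0)"
  define t where "t \<sigma> a = (\<Prod>\<omega>\<leftarrow>a c. - z (\<omega>, m)) * (\<Prod>r<n - 1. z (\<sigma> (r + 2), sh r m) *
        comm_weight (\<lambda>v i. z (v, i)) (a (\<sigma> (r + 2))) (sh r m) (sh (Suc r) m))" for \<sigma> a
  \<comment> \<open>Along the orbit \<open>z (\<omega>, _)\<close> drops from 0 to -1 on reaching
    position \<open>part \<omega> - 1\<close>. Already being -1 at the start marks place 1; a drop
    between positions \<open>r\<close> and \<open>r + 1\<close> marks place
    \<open>r + 2\<close>.\<close>
  have z_m: "- z (\<omega>, m) = (if part \<omega> = 1 then 1 else 0)" if "\<omega> \<in> \<Omega>" for \<omega>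
    using pos[of 0] n_pos part[OF that] that by (auto simp: z_def sh_0 \<open>m < s\<close>)
  have z_diff: "z (\<omega>, sh r m) - z (\<omega>, sh (Suc r) m) = (if part \<omega> = r + 2 then 1 else 0)"
    if "\<omega> \<in> \<Omega>" "r < n - 1" for \<omega> r
    using that pos[of r] pos[of "Suc r"] by (auto simp: z_def)
  have z_X: "z (\<sigma> (r + 2), sh r m) = (if \<sigma> (r + 2) = \<sigma>\<^sub>0 (r + 2) then 1 else 0)"
    if "\<sigma> permutes {1..n}" "r < n - 1" for \<sigma> r
  proof -
    have "r + 2 \<in> {1..n}" using that(2) by auto
    hence "\<sigma> (r + 2) \<in> {1..n}" by (simp only: permutes_in_image[OF that(1)])
    hence "\<sigma> (r + 2) \<notin> \<Omega>" using disj_\<Omega> by blast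
    thus ?thesis using that(2) pos[of r] by (simp add: z_def)
  qed
  \<comment> \<open>All factors of a nonzero product are nonzero: the shift weights determine
    \<open>\<sigma>\<close> place by place, while the initial entries and the differences determine
    the place of each \<omega>.\<close>
  have \<sigma>_eq: "\<sigma> = \<sigma>\<^sub>0" and a_eq: "a = a\<^sub>0"
    if \<sigma>: "\<sigma> permutes {1..n}" "\<sigma> 1 = c" and a: "a \<in> seq_partitions n \<Omega>" and nz: "t \<sigma> a \<noteq> 0" for \<sigma> a
  proof -
    have nz1: "- z (\<omega>, m) \<noteq> 0" if "\<omega> \<in> set (a c)" for \<omega>
      using nz that by (auto simp: t_def prod_list_zero_iff)
    have nz2: "z (\<sigma> (r + 2), sh r m) \<noteq> 0" if "r < n - 1" for r
      using nz that by (auto simp: t_def)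
    have nz3: "z (\<omega>, sh r m) - z (\<omega>, sh (Suc r) m) \<noteq> 0"
      if "r < n - 1" "\<omega> \<in> set (a (\<sigma> (r + 2)))" for r \<omega>
    proof -
      have "comm_weight (\<lambda>v i. z (v, i)) (a (\<sigma> (r + 2))) (sh r m) (sh (Suc r) m) \<noteq> 0"
        using nz that(1) by (auto simp: t_def)
      thus ?thesis using that(2) by (force simp: comm_weight_def prod_list_zero_iff)
    qed
    have k_cases: "k = 1 \<or> (\<exists>r<n - 1. k = r + 2)" if "k \<in> {1..n}" for k
      using that by (cases "k = 1") (auto intro!: exI[of _ "k - 2"])
    show "\<sigma> = \<sigma>\<^sub>0"
    proof
      fix k show "\<sigma> k = \<sigma>\<^sub>0 k"
      proof (cases "k \<in> {1..n}")
        case True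
        from k_cases[OF this] show ?thesis
        proof (elim disjE exE conjE)
          fix r assume r: "r < n - 1" "k = r + 2"
          show ?thesis using nz2[OF r(1)] z_X[OF \<sigma>(1) r(1)] r(2) by (auto split: if_splits)
        qed (use \<sigma>(2) in simp)
      next
        case False
        then show ?thesis using \<sigma>(1) \<sigma>\<^sub>0 by (simp add: permutes_not_in)
      qed
    qed
    show "a = a\<^sub>0"
    proof (rule seq_partitions_eqI[OF a a\<^sub>0])
      fix i assume i: "i \<in> {1..n}"
      then obtain k where k: "k \<in> {1..n}" "i = \<sigma>\<^sub>0 k"
        using permutes_image[OF \<sigma>\<^sub>0] by blast
      show "set (a i) \<subseteq> set (a\<^sub>0 i)"
      proof
        fix \<omega> assume \<omega>: "\<omega> \<in> set (a i)"
        hence "\<omega> \<in> \<Omega>" using seq_partitions_set[OF a i] by blast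
        have "part \<omega> = k"
          using k_cases[OF k(1)]
        proof (elim disjE exE conjE)
          assume "k = 1"
          thus ?thesis using nz1[of \<omega>] \<omega> k(2) z_m[OF \<open>\<omega> \<in> \<Omega>\<close>] by (auto split: if_splits)
        next
          fix r assume "r < n - 1" "k = r + 2"
          thus ?thesis using nz3[of r \<omega>] \<omega> k(2) \<open>\<sigma> = \<sigma>\<^sub>0\<close> z_diff[OF \<open>\<omega> \<in> \<Omega>\<close>]
            by (auto split: if_splits)
        qed
        thus "\<omega> \<in> set (a\<^sub>0 i)" using part[OF \<open>\<omega> \<in> \<Omega>\<close>] k(2) by simp
      qed
    qed
  qed
  have prod_1: "(\<Prod>\<omega>\<leftarrow>ws. g \<omega>) = 1" if "\<And>\<omega>. \<omega> \<in> set ws \<Longrightarrow> g \<omega> = 1" for ws and g :: "nat \<Rightarrow> 'F"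
    using that by (induction ws) auto
  have a\<^sub>0_\<Omega>: "\<omega> \<in> \<Omega>" "part \<omega> = k" if "k \<in> {1..n}" "\<omega> \<in> set (a\<^sub>0 (\<sigma>\<^sub>0 k))" for \<omega> k
  proof -
    have "\<sigma>\<^sub>0 k \<in> {1..n}" using that(1) by (simp only: permutes_in_image[OF \<sigma>\<^sub>0])
    thus "\<omega> \<in> \<Omega>" using seq_partitions_set[OF a\<^sub>0] that(2) by blast
    thus "part \<omega> = k" using part_eq that by blast
  qed
  have "t \<sigma>\<^sub>0 a\<^sub>0 = 1"
  proof -
    have "(\<Prod>\<omega>\<leftarrow>a\<^sub>0 c. - z (\<omega>, m)) = 1"
      using a\<^sub>0_\<Omega>[of 1] n_pos z_m by (intro prod_1) auto
    moreover have "comm_weight (\<lambda>v i. z (v, i)) (a\<^sub>0 (\<sigma>\<^sub>0 (r + 2))) (sh r m) (sh (Suc r) m) = 1"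
      if "r < n - 1" for r
      unfolding comm_weight_def using a\<^sub>0_\<Omega>[of "r + 2"] that z_diff by (intro prod_1) auto
    ultimately show ?thesis
      using z_X[OF \<sigma>\<^sub>0] by (simp add: t_def)
  qed
  have "\<gamma> z m = (\<Sum>\<sigma> | \<sigma> permutes {1..n} \<and> \<sigma> 1 = c. \<Sum>a\<in>seq_partitions n \<Omega>. l \<sigma> a * t \<sigma> a)"
    by (simp add: \<gamma>_def t_def)
  also have "\<dots> = (\<Sum>\<sigma> | \<sigma> permutes {1..n} \<and> \<sigma> 1 = c. \<Sum>a\<in>seq_partitions n \<Omega>.
      if a = a\<^sub>0 then if \<sigma> = \<sigma>\<^sub>0 then l \<sigma>\<^sub>0 a\<^sub>0 * t \<sigma>\<^sub>0 a\<^sub>0 else 0 else 0)"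
  proof (intro sum.cong refl)
    fix \<sigma> a assume "\<sigma> \<in> {\<sigma>. \<sigma> permutes {1..n} \<and> \<sigma> 1 = c}" "a \<in> seq_partitions n \<Omega>"
    hence "t \<sigma> a = 0 \<or> \<sigma> = \<sigma>\<^sub>0 \<and> a = a\<^sub>0" using \<sigma>_eq a_eq by blast
    moreover have "t \<sigma>\<^sub>0 a\<^sub>0 \<noteq> 0" using \<open>t \<sigma>\<^sub>0 a\<^sub>0 = 1\<close> by simp
    ultimately show "l \<sigma> a * t \<sigma> a = (if a = a\<^sub>0 then if \<sigma> = \<sigma>\<^sub>0 then l \<sigma>\<^sub>0 a\<^sub>0 * t \<sigma>\<^sub>0 a\<^sub>0 else 0 else 0)"
      by auto
  qed
  also have "\<dots> = l \<sigma>\<^sub>0 a\<^sub>0"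
    using \<sigma>\<^sub>0 a\<^sub>0 \<open>t \<sigma>\<^sub>0 a\<^sub>0 = 1\<close> finite_seq_partitions[OF fin_\<Omega>] by (simp add: finite_permutations)
  finally show ?thesis using l\<^sub>0 by (intro exI[of _ z]) simp
qed

text \<open>A single generic \<open>z\<close> makes the operator invertible on all off-diagonal
  blocks, after which \<open>Y\<close> is found block by block.\<close>

lemma ex_value:
  fixes T :: "nat \<Rightarrow> nat \<Rightarrow> 'F"
  assumes T: "\<And>i k. i < s \<Longrightarrow> k < s \<Longrightarrow> i mod b = k mod b \<Longrightarrow> T i k = 0"
  shows "\<exists>z Y. \<forall>i<s. \<forall>k<s. (\<Sum>j<s. \<Sum>m<s. op_coeff z (i, k) (j, m) * Y j m) = T i k"
proof -
  define B where "B p q = {(i, k). i < s \<and> k < s \<and> i mod b = p \<and> k mod b = q}" for p q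
  have B_sub: "B p q \<subseteq> {..<s} \<times> {..<s}" for p q by (auto simp: B_def)
  hence fin_B: "finite (B p q)" for p q using finite_subset by blast
  obtain z\<^sub>1 where z\<^sub>1: "\<And>m. m \<in> {..<s} \<Longrightarrow> \<gamma> z\<^sub>1 m \<noteq> 0"
    by (rule line_poly_common_nonzero[OF inf, of "{..<s}" "\<lambda>m z. \<gamma> z m"])
      (auto simp: line_poly_\<gamma> \<gamma>_nonzero)
  have "\<exists>\<Delta>. line_poly \<Delta> \<and> (\<forall>z. \<Delta> z \<noteq> 0 \<longleftrightarrow> solvable_system (B p q) (op_coeff z))" for p q
    by (rule solvable_system_line_poly[where M = op_coeff, OF fin_B[of p q] line_poly_op_coeff]) blast
  then obtain \<Delta> where \<Delta>_line: "\<And>p q. line_poly (\<Delta> p q)"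
    and \<Delta>: "\<And>p q z. \<Delta> p q z \<noteq> 0 \<longleftrightarrow> solvable_system (B p q) (op_coeff z)" by metis
  \<comment> \<open>Solvability on a block is a non-vanishing condition, so one special parameter
    suffices to make it generic.\<close>
  have \<Delta>_nonzero: "\<exists>z. \<Delta> p q z \<noteq> 0" if "p \<noteq> q" for p q
  proof -
    \<comment> \<open>Block \<open>p\<close> is switched off; since \<open>p \<noteq> q\<close>, the
      factors \<open>\<gamma>\<close> on block \<open>q\<close> keep their nonzero values.\<close>
    define z where "z = (\<lambda>(v, i). if i mod b = p then 0 else z\<^sub>1 (v, i))"
    have z0: "z (v, i) = 0" if "i mod b = p" for v i using that by (simp add: z_def)
    have \<gamma>_z: "\<gamma> z m \<noteq> 0" if "m < s" "m mod b = q" for m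
    proof -
      have "\<gamma> z m = \<gamma> z\<^sub>1 m" using that(2) \<open>p \<noteq> q\<close> by (intro \<gamma>_cong) (auto simp: z_def)
      thus ?thesis using z\<^sub>1 that(1) by simp
    qed
    have "solvable_system (B p q) (op_coeff z)"
      unfolding solvable_system_def
    proof
      fix w :: "nat \<times> nat \<Rightarrow> 'F"
      \<comment> \<open>Inverts the right multiplication: the entry \<open>(i, k)\<close> of the
        image is \<open>\<gamma> z m\<close> times the entry \<open>(i, m)\<close> of the preimage,
        where \<open>k = sh (n - 1) m\<close>, equivalently \<open>m = sh 1 k\<close>.\<close>
      define y where "y = (\<lambda>(j, m). w (j, sh (n - 1) m) / \<gamma> z m)"
      have "(\<Sum>jm\<in>B p q. op_coeff z (i, k) jm * y jm) = w (i, k)" if "(i, k) \<in> B p q" for i k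
      proof -
        have ik: "i < s" "k < s" "i mod b = p" "k mod b = q" using that by (auto simp: B_def)
        have inv: "sh (n - 1) (sh 1 k) = k" "\<And>m. m < s \<Longrightarrow> sh 1 (sh (n - 1) m) = m"
          using n_pos ik(2) sh_n by (simp_all add: sh_sh)
        have "(\<Sum>jm\<in>B p q. op_coeff z (i, k) jm * y jm)
          = (\<Sum>jm\<in>B p q. if jm = (i, sh 1 k) then w (i, k) else 0)"
        proof (rule sum.cong[OF refl])
          fix jm assume "jm \<in> B p q"
          then obtain j m where jm: "jm = (j, m)" "j < s" "m < s" "j mod b = p" "m mod b = q"
            by (auto simp: B_def)
          have iff: "k = sh (n - 1) m \<longleftrightarrow> m = sh 1 k" using inv jm(3) by metis
          show "op_coeff z (i, k) jm * y jm = (if jm = (i, sh 1 k) then w (i, k) else 0)"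
            using op_coeff_special[of p z, OF z0 ik(1) jm(3) ik(3) jm(4), where k = k]
              \<gamma>_z[OF jm(3,5)] iff by (auto simp: y_def jm(1))
        qed
        also have "\<dots> = w (i, k)"
          using ik fin_B by (auto simp: B_def)
        finally show ?thesis .
      qed
      thus "\<exists>y. \<forall>ik\<in>B p q. (\<Sum>jm\<in>B p q. op_coeff z ik jm * y jm) = w ik" by fast
    qed
    thus ?thesis using \<Delta> by blast
  qed
  have "\<exists>z. \<forall>p<b. \<forall>q<b. p \<noteq> q \<longrightarrow> \<Delta> p q z \<noteq> 0"
  proof -
    have "finite {(p, q). p < b \<and> q < b \<and> p \<noteq> q}"
      by (rule finite_subset[of _ "{..<b} \<times> {..<b}"]) auto
    then obtain z where "\<And>pq. pq \<in> {(p, q). p < b \<and> q < b \<and> p \<noteq> q} \<Longrightarrow> \<Delta> (fst pq) (snd pq) z \<noteq> 0"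
      by (rule line_poly_common_nonzero[OF inf, of _ "\<lambda>pq. \<Delta> (fst pq) (snd pq)"])
        (use \<Delta>_nonzero \<Delta>_line in auto)
    thus ?thesis by fastforce
  qed
  then obtain z where z: "\<And>p q. p < b \<Longrightarrow> q < b \<Longrightarrow> p \<noteq> q \<Longrightarrow> solvable_system (B p q) (op_coeff z)"
    using \<Delta> by blast
  have "\<exists>y. p < b \<longrightarrow> q < b \<longrightarrow> p \<noteq> q \<longrightarrow>
      (\<forall>ik\<in>B p q. (\<Sum>jm\<in>B p q. op_coeff z ik jm * y jm) = case_prod T ik)" for p q
    using z unfolding solvable_system_def by blast
  then obtain y where y: "\<And>p q ik. p < b \<Longrightarrow> q < b \<Longrightarrow> p \<noteq> q \<Longrightarrow> ik \<in> B p q \<Longrightarrow>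
      (\<Sum>jm\<in>B p q. op_coeff z ik jm * y p q jm) = case_prod T ik" by metis
  \<comment> \<open>Zero diagonal blocks of \<open>Y\<close> match the vanishing diagonal blocks of
    \<open>T\<close>.\<close>
  define Y where "Y j m = (if j mod b = m mod b then 0 else y (j mod b) (m mod b) (j, m))" for j m
  have "(\<Sum>j<s. \<Sum>m<s. op_coeff z (i, k) (j, m) * Y j m) = T i k" if ik: "i < s" "k < s" for i k
  proof -
    let ?p = "i mod b" and ?q = "k mod b"
    have "(\<Sum>j<s. \<Sum>m<s. op_coeff z (i, k) (j, m) * Y j m)
        = (\<Sum>(j, m)\<in>{..<s} \<times> {..<s}. op_coeff z (i, k) (j, m) * Y j m)"
      by (rule sum.cartesian_product)
    also have "\<dots> = (\<Sum>(j, m)\<in>B ?p ?q. op_coeff z (i, k) (j, m) * Y j m)"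
    proof (rule sum.mono_neutral_right)
      show "\<forall>jm\<in>{..<s} \<times> {..<s} - B ?p ?q. (case jm of (j, m) \<Rightarrow> op_coeff z (i, k) (j, m) * Y j m) = 0"
        using op_coeff_eq_0[OF ik(1)] by (fastforce simp: B_def)
    qed (use B_sub in auto)
    also have "\<dots> = T i k"
    proof (cases "?p = ?q")
      case True
      then have "(\<Sum>(j, m)\<in>B ?p ?q. op_coeff z (i, k) (j, m) * Y j m) = 0"
        by (intro sum.neutral) (auto simp: B_def Y_def)
      with T[OF ik True] show ?thesis by simp
    next
      case False
      have "(\<Sum>(j, m)\<in>B ?p ?q. op_coeff z (i, k) (j, m) * Y j m)
        = (\<Sum>jm\<in>B ?p ?q. op_coeff z (i, k) jm * y ?p ?q jm)"
        using False by (intro sum.cong) (auto simp: B_def Y_def)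
      also have "\<dots> = T i k"
        using y[OF _ _ False, of "(i, k)"] ik b_pos by (simp add: B_def)
      finally show ?thesis .
    qed
    finally show ?thesis .
  qed
  thus ?thesis by blast
qed

end

section \<open>Trace zero matrices as values of \<open>f\<close>\<close>

theorem theorem3p5:
  fixes d n :: nat and \<Omega> :: "nat set" and f :: "'F::field pc_poly"
  assumes "infinite (UNIV :: 'F set)"
    and "d \<ge> 1"
    and "n \<ge> 1"
    and "finite \<Omega>"
    and "\<Omega> \<subseteq> {1..} - {1..n}"
    and "f \<in> pc_polys n \<Omega>"
    and "f \<noteq> 0"
    and "admissible n \<Omega> f"
  shows "\<exists>s\<ge>d. embed_mat d s ` sl_mat d \<subseteq> pc_image (mat_algebra TYPE('F) s) n \<Omega> f"
proof -
  obtain l :: "(nat \<Rightarrow> nat) \<Rightarrow> (nat \<Rightarrow> nat list) \<Rightarrow> 'F" where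
    f: "f = (\<Sum>\<sigma> | \<sigma> permutes {1..n}. \<Sum>a\<in>seq_partitions n \<Omega>.
      pc_const (l \<sigma> a) * prod_list (map (\<lambda>i. pc_X_sup a (\<sigma> i)) [1..<n+1]))"
    using assms(8) by (auto simp only: admissible_def)
  have "\<exists>\<sigma> a. \<sigma> permutes {1..n} \<and> a \<in> seq_partitions n \<Omega> \<and> l \<sigma> a \<noteq> 0"
  proof (rule ccontr)
    assume "\<nexists>\<sigma> a. \<sigma> permutes {1..n} \<and> a \<in> seq_partitions n \<Omega> \<and> l \<sigma> a \<noteq> 0"
    hence "f = 0" unfolding f by (intro sum.neutral ballI) (simp add: pc_const_def)
    with \<open>f \<noteq> 0\<close> show False by contradiction
  qed
  then obtain \<sigma>\<^sub>0 a\<^sub>0 where "\<sigma>\<^sub>0 permutes {1..n}" "a\<^sub>0 \<in> seq_partitions n \<Omega>" "l \<sigma>\<^sub>0 a\<^sub>0 \<noteq> 0" by blast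
  \<comment> \<open>One block for each index of the corner, the spare index \<open>d\<close>
    included, so \<open>s\<close> is \<open>(d + 1) * n\<close>.\<close>
  then interpret block_operator "d + 1" n \<Omega> l \<sigma>\<^sub>0 a\<^sub>0
    using assms by unfold_locales auto
  have "d < s" using \<open>n \<ge> 1\<close> by (cases n) auto
  have "embed_mat d s B \<in> pc_image (mat_algebra TYPE('F) s) n \<Omega> f" if B: "B \<in> sl_mat d" for B
  proof -
    obtain Z where sim: "similar_mat (embed_mat d s B) Z" and Z: "Z \<in> carrier_mat s s"
      and Z_diag: "\<And>i. i < s \<Longrightarrow> Z $$ (i, i) = 0"
      and Z_supp: "\<And>i k. i < s \<Longrightarrow> k < s \<Longrightarrow> \<not> (i \<le> d \<and> k \<le> d) \<Longrightarrow> Z $$ (i, k) = 0"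
      using embed_mat_similar_zero_diag[OF assms(1) B \<open>d < s\<close>] by blast
    \<comment> \<open>Distinct indices up to \<open>d\<close> have distinct residues, so inside the
      corner the diagonal blocks contain only diagonal entries of \<open>Z\<close>, and outside it
      \<open>Z\<close> vanishes.\<close>
    have "Z $$ (i, k) = 0" if "i < s" "k < s" "i mod (d + 1) = k mod (d + 1)" for i k
      using Z_diag[of i] Z_supp[of i k] that by (cases "i \<le> d \<and> k \<le> d") auto
    then obtain z Y where zY: "\<forall>i<s. \<forall>k<s.
        (\<Sum>j<s. \<Sum>m<s. op_coeff z (i, k) (j, m) * Y j m) = Z $$ (i, k)"
      using ex_value[of "\<lambda>i k. Z $$ (i, k)"] by blast
    define X where "X j i k = (if j = c then Y i k else if k = sh 1 i then z (j, i) else 0)" for j i k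
    define x where "x j = mat s s (\<lambda>(i, k). X j i k)" for j
    define u where "u \<omega> = mat s s (\<lambda>(i, k). if i = k then z (\<omega>, i) else 0)" for \<omega>
    have "pc_ev (mat_algebra TYPE('F) s) x u f = mat s s (\<lambda>(i, k). \<Sum>\<sigma>\<in>perms. \<Sum>a\<in>seq_partitions n \<Omega>.
        l \<sigma> a * path_sum s (map (\<lambda>j i k. comm_weight (\<lambda>v i. z (v, i)) (a j) i k * X j i k) (map \<sigma> [1..<n+1])) i k)"
      unfolding f x_def[abs_def] u_def[abs_def] by (rule diag_ev_admissible[OF \<open>finite \<Omega>\<close>])
    also have "\<dots> = mat s s (\<lambda>(i, k). \<Sum>j<s. \<Sum>m<s. op_coeff z (i, k) (j, m) * Y j m)"
      unfolding X_def by (rule cong_mat) (simp_all only: split_conv sum_path_sum_eq_op_coeff)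
    also have "\<dots> = Z" using zY Z by (intro eq_matI) auto
    finally have "pc_ev (mat_algebra TYPE('F) s) x u f = Z" .
    hence "Z \<in> pc_image (mat_algebra TYPE('F) s) n \<Omega> f"
      using diag_ev_image[of s X "\<lambda>v i. z (v, i)" f n \<Omega>] by (simp add: x_def[abs_def] u_def[abs_def])
    from pc_image_conj[OF assms(6) this Z sim] show ?thesis .
  qed
  with \<open>d < s\<close> show ?thesis by (intro exI[of _ s]) auto
qed

end
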